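(* Let $0<q<1$, let $r$ be a positive integer and $n$ an integer or half-integer such that $n\ge (r-1)/2$. Then $$\sum_{k_1,\dots,k_r=-n}^n\ \prod_{1\le i<j\le r}\big|[k_i-k_j]_q\big|\ \prod_{i=1}^r q^{(k_i+n-r+i)^2/2}\begin{bmatrix}2n\\ n+k_i\end{bmatrix}_q$$ $$=\frac{r!}{[r]_{q^{1/2}}!}\prod_{i=1}^r(-q^{1/2};q^{1/2})_i\,(-q^{i/2+1};q)_{2n-r}\ \prod_{i=1}^r\frac{\Gamma_q(1+\frac12 i)}{\Gamma_q(\frac32)}\cdot\frac{\Gamma_q(2n+1)\,\Gamma_q(2n-i+\frac52)}{\Gamma_q(2n-i+2)\,\Gamma_q(2n-\frac12 i+2)}.$$
   Context: Each $k_i$ runs over $\{-n,-n+1,\dots,n\}$ (half-integers if $n$ is a half-integer, i.e. an element of $\frac12+\mathbb{Z}$). Notation: $(a;q)_\infty=\prod_{k\ge1}(1-aq^{k-1})$, $(a;q)_k=(a;q)_\infty/(aq^k;q)_\infty$ for any integer $k$ (so $(a;q)_{-1}=1/(1-aq^{-1})$); $\begin{bmatrix}N\\ M\end{bmatrix}_q=\frac{(q;q)_N}{(q;q)_M(q;q)_{N-M}}$ for integers $0\le M\le N$; $[x]_q=\frac{1-q^x}{1-q}$; $[r]_q!=[1]_q[2]_q\cdots[r]_q$; $\Gamma_q(x)=(1-q)^{1-x}\frac{(q;q)_\infty}{(q^x;q)_\infty}$. The same notation is used with $q$ replaced by $q^{1/2}$. *)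

theory Defs
  imports "HOL-Analysis.Analysis"
begin

text \<open>The infinite product runs over \<open>k \<ge> 0\<close>, which is the product of
  \<open>1 - a q\<^sup>k\<^sup>-\<^sup>1\<close> over \<open>k \<ge> 1\<close> reindexed.\<close>

definition qpoch_inf :: "real \<Rightarrow> real \<Rightarrow> real" where
  "qpoch_inf a q = prodinf (\<lambda>k. 1 - a * q ^ k)"

definition qpoch :: "real \<Rightarrow> real \<Rightarrow> int \<Rightarrow> real" where
  "qpoch a q k = qpoch_inf a q / qpoch_inf (a * q powi k) q"

text \<open>Only meaningful for \<open>0 \<le> M \<le> N\<close>.\<close>

definition qbinom :: "real \<Rightarrow> int \<Rightarrow> int \<Rightarrow> real" where
  "qbinom q N M = qpoch q q N / (qpoch q q M * qpoch q q (N - M))"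

definition qbracket :: "real \<Rightarrow> real \<Rightarrow> real" where
  "qbracket q x = (1 - q powr x) / (1 - q)"

definition qfact :: "real \<Rightarrow> nat \<Rightarrow> real" where
  "qfact q r = (\<Prod>i=1..r. qbracket q (real i))"

definition qGamma :: "real \<Rightarrow> real \<Rightarrow> real" where
  "qGamma q x = (1 - q) powr (1 - x) * qpoch_inf q q / qpoch_inf (q powr x) q"

text \<open>The set \<open>{-n, -n+1, \<dots>, n}\<close> for an integer or half-integer \<open>n\<close>, as a set of reals.\<close>

definition steps :: "real \<Rightarrow> real set" where
  "steps n = {k. - n \<le> k \<and> k \<le> n \<and> n + k \<in> \<int>}"

end

theory Submission
  imports Defs "Jordan_Normal_Form.Determinant" "HOL-Computational_Algebra.Polynomial"
begin

text \<open>Put \<open>N = 2n\<close>, \<open>m = N + 1 - r\<close> and \<open>k\<^sub>i = n - a\<^sub>i\<close> with \<open>0 \<le> a\<^sub>i \<le> N\<close>.  Although the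
  exponents of \<open>q\<close> in the sum depend on the index \<open>i\<close>, the powers of \<open>q\<close> that come from the
  absolute values \<open>\<bar>[k\<^sub>i - k\<^sub>j]\<bar>\<close> restore the symmetry: up to a constant, the summand is
  \<open>V(q\<^sup>K)\<close> times a product over \<open>a \<in> K\<close> of \<open>q powr (a\<^sup>2/2 - a N)\<close> and a \<open>q\<close>-binomial coefficient, where
  \<open>K = {a\<^sub>1, \<dots>, a\<^sub>r}\<close>, \<open>q\<^sup>K = {q\<^sup>a | a \<in> K}\<close> and \<open>V\<close> is the absolute value of the Vandermonde product.
  So the sum is \<open>r!\<close> times a sum over \<open>r\<close>-element subsets \<open>K\<close> of \<open>{0..N}\<close>.

  The weight of \<open>a\<close> is, up to a constant, \<open>q powr (- a/2)\<close> divided by the product of all distances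
  \<open>\<bar>q\<^sup>a - q\<^sup>b\<bar>\<close>, \<open>b \<noteq> a\<close>.  Dividing \<open>V(q\<^sup>K)\<close> by these distances gives \<open>V\<close> of the complement, up to a
  constant (\<open>vdm_complement\<close>).  Hence the problem is to sum \<open>V(q\<^sup>L)\<close> times the product of the
  \<open>q powr (l/2)\<close> over all \<open>m\<close>-element subsets \<open>L\<close> of \<open>{0..N}\<close>.  Each such term is a maximal minor
  of the matrix \<open>(x\<^sub>i\<^sup>l)\<close> at \<open>x\<^sub>i = q powr (i + 1/2)\<close>, up to the order of the rows
  (\<open>minor_sum_geometric\<close>); in other words, the sum is a multiple of the sum of the Schur functions
  \<open>s\<^sub>\<lambda>(q powr (1/2), \<dots>, q powr (m - 1/2))\<close> over the partitions \<open>\<lambda>\<close> in an \<open>m\<close> by \<open>r\<close> box, which is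
  MacMahon's generating function for symmetric plane partitions in the variable \<open>q powr (1/2)\<close>.

  Macdonald's bounded Schur function sum evaluates the sum of the minors for arbitrary \<open>x\<^sub>i\<close>:
  multiplied by \<open>\<Prod>\<^sub>i (1 - x\<^sub>i) \<Prod>\<^sub>i\<^sub><\<^sub>j (1 - x\<^sub>i x\<^sub>j)\<close> it equals the determinant with entries
  \<open>x\<^sub>i ^ j - x\<^sub>i ^ (N + m - j)\<close>, \<open>0 \<le> j < m\<close> (\<open>folded_det_eq_minor_sum\<close>).  To prove this, the determinant is
  expanded into \<open>2 ^ m\<close> Vandermonde determinants, one for each set \<open>S\<close> of variables that are
  inverted.  Removing the largest exponent from \<open>L\<close> gives a recursion for the sum of minors, and
  the expansion satisfies it separately for each \<open>S\<close>; what is needed there is a partial fraction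
  identity that follows from Lagrange interpolation with the two extra nodes \<open>0\<close> and \<open>- 1\<close>.

  At the geometric progression \<open>x\<^sub>i = q powr (i + 1/2)\<close> the determinant is, after scaling rows and
  columns, the transpose of one of the same kind, at \<open>u\<^sub>j = q powr (j + (r + 1)/2)\<close> and with
  \<open>L = {0..<m}\<close> as the only admissible subset.  Macdonald's formula applied a second time
  therefore evaluates it as a product (\<open>geometric_minor_sum\<close>).  The final step,
  \<open>gamma_product_eq_box\<close>, identifies this product with the quotient of \<open>q\<close>-Gamma functions by induction
  on \<open>r\<close> with \<open>m\<close> fixed.\<close>

section \<open>Products over pairs\<close>

definition pairs :: "'a::linorder set \<Rightarrow> ('a \<times> 'a) set" where
  "pairs X = {(a, b). a \<in> X \<and> b \<in> X \<and> a < b}"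

lemma finite_pairs [simp]: "finite X \<Longrightarrow> finite (pairs X)"
  by (rule finite_subset[of _ "X \<times> X"]) (auto simp: pairs_def)

lemma pairs_empty [simp]: "pairs {} = {}"
  by (simp add: pairs_def)

lemma prod_pairs_cong:
  assumes "\<And>a b. a \<in> X \<Longrightarrow> b \<in> X \<Longrightarrow> a < b \<Longrightarrow> f a b = g a b"
  shows "(\<Prod>(a, b)\<in>pairs X. f a b) = (\<Prod>(a, b)\<in>pairs X. g a b)"
  by (rule prod.cong) (auto simp: pairs_def assms)

lemma prod_pairs_distrib:
  "(\<Prod>(a, b)\<in>pairs X. f a b * g a b) =
     (\<Prod>(a, b)\<in>pairs X. f a b) * (\<Prod>(a, b)\<in>pairs X. g a b :: 'b::comm_monoid_mult)"
  by (simp add: prod.distrib case_prod_unfold)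

text \<open>For a symmetric factor an unordered pair can be read in either order; this makes it possible to
  single out one element without tracking how it compares with the others.\<close>
lemma prod_pairs_insert:
  fixes f :: "'a::linorder \<Rightarrow> 'a \<Rightarrow> 'b::comm_monoid_mult"
  assumes "finite X" "z \<notin> X"
    and sym: "\<And>a. a \<in> X \<Longrightarrow> f a z = f z a"
  shows "(\<Prod>(a, b)\<in>pairs (insert z X). f a b) = (\<Prod>(a, b)\<in>pairs X. f a b) * (\<Prod>y\<in>X. f z y)"
proof -
  define h where "h y = (if z < y then (z, y) else (y, z))" for y
  have eq: "pairs (insert z X) = pairs X \<union> h ` X"
    using \<open>z \<notin> X\<close> by (auto simp: pairs_def h_def image_iff not_less le_less split: if_splits)
  have "pairs X \<inter> h ` X = {}"
    using \<open>z \<notin> X\<close> by (auto simp: pairs_def h_def split: if_splits)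
  hence "(\<Prod>(a, b)\<in>pairs (insert z X). f a b) =
      (\<Prod>(a, b)\<in>pairs X. f a b) * (\<Prod>(a, b)\<in>h ` X. f a b)"
    unfolding eq using assms by (subst prod.union_disjoint) auto
  also have "(\<Prod>(a, b)\<in>h ` X. f a b) = (\<Prod>y\<in>X. f z y)"
  proof (subst prod.reindex)
    show "inj_on h X" using \<open>z \<notin> X\<close> by (auto simp: inj_on_def h_def split: if_splits)
    show "prod ((\<lambda>(a, b). f a b) \<circ> h) X = (\<Prod>y\<in>X. f z y)"
      by (rule prod.cong) (auto simp: h_def sym)
  qed
  finally show ?thesis .
qed

lemma prod_pairs_remove:
  fixes f :: "'a::linorder \<Rightarrow> 'a \<Rightarrow> 'b::comm_monoid_mult"
  assumes "finite X" "z \<in> X" and "\<And>a b. f a b = f b a"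
  shows "(\<Prod>(a, b)\<in>pairs X. f a b) =
    (\<Prod>(a, b)\<in>pairs (X - {z}). f a b) * (\<Prod>y\<in>X - {z}. f z y)"
  using prod_pairs_insert[of "X - {z}" z f] assms by (simp add: insert_absorb)

lemma prod_pairs_mult:
  fixes f :: "'a::linorder \<Rightarrow> 'b::comm_monoid_mult"
  assumes "finite X"
  shows "(\<Prod>(a, b)\<in>pairs X. f a * f b) = (\<Prod>a\<in>X. f a) ^ (card X - 1)"
  using assms
proof induction
  case (insert z X)
  show ?case
  proof (cases "X = {}")
    case False
    hence "card X = Suc (card X - 1)" using insert by (simp add: card_gt_0_iff)
    hence c: "prod f X ^ card X = prod f X ^ (card X - 1) * prod f X"
      by (metis power_Suc2)
    show ?thesis using insert
      by (simp add: prod_pairs_insert mult.commute prod.distrib c power_mult_distrib mult_ac)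
  qed (simp add: pairs_def, auto intro!: prod.neutral)
qed (simp add: pairs_def)

lemma prod_pairs_image:
  fixes g :: "'b::linorder \<Rightarrow> 'b \<Rightarrow> 'c::comm_monoid_mult" and f :: "'a::linorder \<Rightarrow> 'b"
  assumes "finite X" "inj_on f X" and sym: "\<And>a b. g a b = g b a"
  shows "(\<Prod>(a, b)\<in>pairs (f ` X). g a b) = (\<Prod>(a, b)\<in>pairs X. g (f a) (f b))"
  using assms(1,2)
proof induction
  case (insert z X)
  have "(\<Prod>(a, b)\<in>pairs (f ` insert z X). g a b) =
     (\<Prod>(a, b)\<in>pairs (f ` X). g a b) * (\<Prod>y\<in>f ` X. g (f z) y)"
    using insert by (simp add: prod_pairs_insert sym[of _ "f z"])
  also have "\<dots> = (\<Prod>(a, b)\<in>pairs X. g (f a) (f b)) * (\<Prod>y\<in>X. g (f z) (f y))"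
    using insert by (simp add: prod.reindex)
  also have "\<dots> = (\<Prod>(a, b)\<in>pairs (insert z X). g (f a) (f b))"
    using insert by (intro prod_pairs_insert[symmetric]) (auto simp: sym)
  finally show ?case .
qed simp

text \<open>The absolute value keeps the Vandermonde product symmetric, so that it is a function of a set.\<close>
definition vdm :: "real set \<Rightarrow> real" where
  "vdm X = (\<Prod>(a, b)\<in>pairs X. \<bar>a - b\<bar>)"

lemma vdm_pos: "vdm X > 0"
  unfolding vdm_def by (rule prod_pos) (auto simp: pairs_def)

lemma vdm_remove:
  assumes "finite X" "z \<in> X"
  shows "vdm X = vdm (X - {z}) * (\<Prod>y\<in>X - {z}. \<bar>z - y\<bar>)"
  unfolding vdm_def using assms by (rule prod_pairs_remove) (rule abs_minus_commute)

lemma vdm_insert: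
  assumes "finite X" "z \<notin> X"
  shows "vdm (insert z X) = vdm X * (\<Prod>y\<in>X. \<bar>z - y\<bar>)"
  using vdm_remove[of "insert z X" z] assms by simp

lemma vdm_image:
  assumes "finite X" "inj_on f X"
  shows "vdm (f ` X) = (\<Prod>(a, b)\<in>pairs X. \<bar>f a - f b\<bar>)"
  unfolding vdm_def using assms by (rule prod_pairs_image) (rule abs_minus_commute)

section \<open>Lagrange interpolation\<close>

text \<open>The polynomial \<open>p\<close> equals its Lagrange interpolant at the nodes \<open>A\<close>, and every basis polynomial
  has top coefficient 1 divided by the product of the node differences.\<close>
lemma lagrange_top_coeff:
  fixes A :: "real set"
  assumes "finite A" "degree p < card A"
  shows "(\<Sum>a\<in>A. poly p a / (\<Prod>b\<in>A - {a}. (a - b))) = coeff p (card A - 1)"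
proof -
  define w where "w a = (\<Prod>b\<in>A - {a}. (a - b))" for a
  define l where "l a = (\<Prod>b\<in>A - {a}. [:- b, 1:])" for a
  define P where "P = (\<Sum>a\<in>A. Polynomial.smult (poly p a / w a) (l a))"
  have w0: "w a \<noteq> 0" if "a \<in> A" for a
    using assms by (auto simp: w_def)
  have degl: "degree (l a) = card A - 1" if "a \<in> A" for a
    using that assms unfolding l_def by (subst degree_prod_eq_sum_degree) auto
  have lc: "coeff (l a) (card A - 1) = 1" if "a \<in> A" for a
  proof -
    have "lead_coeff (l a) = 1" unfolding l_def by (subst lead_coeff_prod) simp
    thus ?thesis using degl[OF that] by simp
  qed
  have val: "poly (l a) c = (if a = c then w a else 0)" if "a \<in> A" "c \<in> A" for a c
    using that assms by (auto simp: l_def w_def poly_prod)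
  have "P = p"
  proof (rule poly_eqI_degree)
    show "poly P c = poly p c" if "c \<in> A" for c
    proof -
      have "poly P c = (\<Sum>a\<in>A. if a = c then poly p c else 0)"
        unfolding P_def poly_sum using w0 val that by (intro sum.cong) auto
      thus ?thesis using assms that by simp
    qed
    show "degree P < card A" unfolding P_def
    proof (rule order.strict_trans1)
      show "degree (\<Sum>a\<in>A. Polynomial.smult (poly p a / w a) (l a)) \<le> card A - 1"
        using assms degl by (intro degree_sum_le) (auto intro: order.trans[OF degree_smult_le])
    qed (use assms in auto)
    show "degree p < card A" by fact
  qed
  hence "coeff p (card A - 1) = coeff P (card A - 1)"
    by simp
  also have "\<dots> = (\<Sum>a\<in>A. poly p a / w a * coeff (l a) (card A - 1))"
    by (simp only: P_def coeff_sum coeff_smult)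
  also have "\<dots> = (\<Sum>a\<in>A. poly p a / w a)"
    by (intro sum.cong refl) (simp only: lc mult_1_right)
  finally show ?thesis by (simp add: w_def)
qed

section \<open>Vandermonde determinants\<close>
lemma det_scale:
  fixes f :: "nat \<Rightarrow> nat \<Rightarrow> real"
  shows "det (mat M M (\<lambda>(i, j). a i * b j * f i j)) =
    (\<Prod>i<M. a i) * (\<Prod>j<M. b j) * det (mat M M (\<lambda>(i, j). f i j))"
proof -
  have "(\<Prod>i=0..<M. mat M M (\<lambda>(i, j). a i * b j * f i j) $$ (i, p i)) =
      (\<Prod>i<M. a i) * (\<Prod>j<M. b j) * (\<Prod>i=0..<M. mat M M (\<lambda>(i, j). f i j) $$ (i, p i))"
    if p: "p permutes {0..<M}" for p
  proof -
    have "(\<Prod>i=0..<M. mat M M (\<lambda>(i, j). a i * b j * f i j) $$ (i, p i)) =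
        (\<Prod>i=0..<M. a i * b (p i) * mat M M (\<lambda>(i, j). f i j) $$ (i, p i))"
      using permutes_in_image[OF p] by (intro prod.cong) auto
    also have "\<dots> = (\<Prod>i=0..<M. a i) * (\<Prod>i=0..<M. b (p i)) *
        (\<Prod>i=0..<M. mat M M (\<lambda>(i, j). f i j) $$ (i, p i))"
      by (simp add: prod.distrib)
    also have "(\<Prod>i=0..<M. b (p i)) = (\<Prod>i=0..<M. b i)"
      using prod.permute[OF p, of b] by (simp add: o_def)
    finally show ?thesis by (simp add: atLeast0LessThan)
  qed
  thus ?thesis
    by (simp add: det_def'[of _ M] sum_distrib_left algebra_simps)
qed

lemma det_last_column:
  fixes f :: "nat \<Rightarrow> nat \<Rightarrow> real"
  shows "det (mat (Suc m) (Suc m) (\<lambda>(i, j). f i j)) =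
    (\<Sum>i<Suc m. f i m * (-1) ^ (i + m) * det (mat m m (\<lambda>(i', j). f (insert_index i i') j)))"
proof -
  have "mat_delete (mat (Suc m) (Suc m) (\<lambda>(i, j). f i j)) i m =
      mat m m (\<lambda>(i', j). f (insert_index i i') j)" if "i < Suc m" for i
    using that by (intro eq_matI) (auto simp: mat_delete_def insert_index_def)
  thus ?thesis
    by (subst laplace_expansion_column[of _ "Suc m" m]) (auto simp: cofactor_def intro!: sum.cong)
qed

definition vandermonde :: "nat \<Rightarrow> (nat \<Rightarrow> real) \<Rightarrow> real" where
  "vandermonde m x = (\<Prod>(i, j)\<in>pairs {..<m}. x j - x i)"

lemmas insert_index_lessThan = insert_index_image[unfolded atLeast0LessThan]

text \<open>The sign counts the variables after \<open>x i\<close> and is the one that the cofactor expansion along the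
  last column produces.\<close>
lemma vandermonde_skip:
  assumes i: "i < Suc m"
  shows "vandermonde (Suc m) x = (-1) ^ (i + m) * (\<Prod>j\<in>{..<Suc m} - {i}. x i - x j) *
           vandermonde m (\<lambda>j. x (insert_index i j))"
proof -
  \<comment> \<open>The symmetric function that agrees with the Vandermonde factor on ordered pairs.\<close>
  define f where "f a b = (if a < b then x b - x a else x a - x b)" for a b :: nat
  have sym: "f a b = f b a" for a b by (auto simp: f_def)
  have sgn: "(\<Prod>j\<in>{..<Suc m} - {i}. f i j) = (-1) ^ (i + m) * (\<Prod>j\<in>{..<Suc m} - {i}. x i - x j)"
  proof -
    have split: "{..<Suc m} - {i} = {..<i} \<union> {i<..m}" using i by auto
    have "(\<Prod>j\<in>{..<Suc m} - {i}. f i j) = (\<Prod>j<i. x i - x j) * (\<Prod>j\<in>{i<..m}. - 1 * (x i - x j))"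
      unfolding split by (subst prod.union_disjoint) (auto simp: f_def)
    also have "\<dots> = (-1) ^ (m - i) * ((\<Prod>j<i. x i - x j) * (\<Prod>j\<in>{i<..m}. x i - x j))"
      by (subst prod.distrib) simp
    also have "(\<Prod>j<i. x i - x j) * (\<Prod>j\<in>{i<..m}. x i - x j) = (\<Prod>j\<in>{..<Suc m} - {i}. x i - x j)"
      unfolding split by (subst prod.union_disjoint) auto
    also have "(-1) ^ (m - i) = ((-1) ^ (i + m) :: real)"
      using i by (auto simp: minus_one_power_iff)
    finally show ?thesis .
  qed
  have "vandermonde (Suc m) x = (\<Prod>(a, b)\<in>pairs {..<Suc m}. f a b)"
    unfolding vandermonde_def by (rule prod_pairs_cong) (simp add: f_def)
  also have "\<dots> = (\<Prod>(a, b)\<in>pairs (insert_index i ` {..<m}). f a b) *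
      (\<Prod>j\<in>{..<Suc m} - {i}. f i j)"
    unfolding insert_index_lessThan[OF i] using i by (intro prod_pairs_remove sym) auto
  also have "(\<Prod>(a, b)\<in>pairs (insert_index i ` {..<m}). f a b) =
      vandermonde m (\<lambda>j. x (insert_index i j))"
    by (subst prod_pairs_image[OF _ insert_index_inj_on sym])
       (auto simp: vandermonde_def f_def insert_index_def intro!: prod_pairs_cong)
  finally show ?thesis by (simp add: sgn mult_ac)
qed

lemma inj_on_skip:
  assumes "inj_on x {..<Suc m}" "i < Suc m"
  shows "inj_on (\<lambda>j. x (insert_index i j)) {..<m}"
    and "(\<lambda>j. x (insert_index i j)) ` {..<m} = x ` {..<Suc m} - {x i}"
proof -
  have "inj_on x (insert_index i ` {..<m})"
    using assms(1) unfolding insert_index_lessThan[OF assms(2)] by (rule inj_on_subset) auto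
  thus "inj_on (\<lambda>j. x (insert_index i j)) {..<m}"
    using comp_inj_on[OF insert_index_inj_on] by (simp add: o_def)
  have "(\<lambda>j. x (insert_index i j)) ` {..<m} = x ` ({..<Suc m} - {i})"
    unfolding insert_index_lessThan[OF assms(2), symmetric] by auto
  also have "\<dots> = x ` {..<Suc m} - {x i}"
    using assms by (auto simp: inj_on_def)
  finally show "(\<lambda>j. x (insert_index i j)) ` {..<m} = x ` {..<Suc m} - {x i}" .
qed

lemma prod_image_remove:
  assumes "inj_on x {..<Suc m}" "i < Suc m"
  shows "(\<Prod>y\<in>x ` {..<Suc m} - {x i}. g y) = (\<Prod>j\<in>{..<Suc m} - {i}. g (x j))"
proof -
  have "x ` {..<Suc m} - {x i} = x ` ({..<Suc m} - {i})"
    using assms by (auto simp: inj_on_def)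
  moreover have "inj_on x ({..<Suc m} - {i})"
    using assms(1) by (rule inj_on_subset) auto
  ultimately show ?thesis by (simp add: prod.reindex)
qed

text \<open>Expanding along the last column turns the claim into \<open>\<Sum>\<^sub>y y\<^sup>m / \<Prod>\<^sub>z (y - z) = 1\<close>, the top coefficient
  of the polynomial \<open>X\<^sup>m\<close>.\<close>
lemma det_vandermonde:
  assumes "inj_on x {..<m}"
  shows "det (mat m m (\<lambda>(i, j). x i ^ j)) = vandermonde m x"
  using assms
proof (induction m arbitrary: x)
  case 0
  thus ?case by (simp add: vandermonde_def)
next
  case (Suc m)
  let ?X = "x ` {..<Suc m}"
  have "det (mat (Suc m) (Suc m) (\<lambda>(i, j). x i ^ j)) =
     (\<Sum>i<Suc m. x i ^ m * (-1) ^ (i + m) * vandermonde m (\<lambda>j. x (insert_index i j)))"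
    using Suc.prems by (subst det_last_column) (intro sum.cong refl, simp add: Suc.IH inj_on_skip(1))
  also have "\<dots> = (\<Sum>i<Suc m. vandermonde (Suc m) x * (x i ^ m / (\<Prod>y\<in>?X - {x i}. x i - y)))"
  proof (rule sum.cong)
    fix i assume "i \<in> {..<Suc m}"
    hence i: "i < Suc m" by simp
    have "(\<Prod>j\<in>{..<Suc m} - {i}. x i - x j) \<noteq> 0"
      using Suc.prems i by (auto simp: inj_on_def)
    thus "x i ^ m * (-1) ^ (i + m) * vandermonde m (\<lambda>j. x (insert_index i j)) =
        vandermonde (Suc m) x * (x i ^ m / (\<Prod>y\<in>?X - {x i}. x i - y))"
      using Suc.prems i by (simp only: vandermonde_skip[OF i] prod_image_remove) (simp add: field_simps)
  qed simp
  also have "\<dots> = vandermonde (Suc m) x * (\<Sum>y\<in>?X. y ^ m / (\<Prod>z\<in>?X - {y}. y - z))"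
    using Suc.prems by (simp only: sum_distrib_left sum.reindex o_def)
  also have "(\<Sum>y\<in>?X. y ^ m / (\<Prod>z\<in>?X - {y}. y - z)) = 1"
    using lagrange_top_coeff[of ?X "Polynomial.monom 1 m"] Suc.prems
    by (simp add: poly_monom degree_monom_eq card_image)
  finally show ?case by simp
qed

lemma vandermonde_mono:
  assumes "strict_mono_on {..<m} x"
  shows "vandermonde m x = vdm (x ` {..<m})"
proof -
  have "vdm (x ` {..<m}) = (\<Prod>(i, j)\<in>pairs {..<m}. \<bar>x i - x j\<bar>)"
    using strict_mono_on_imp_inj_on[OF assms] by (intro vdm_image) auto
  also have "\<dots> = vandermonde m x"
    unfolding vandermonde_def
  proof (rule prod_pairs_cong)
    fix i j assume "i \<in> {..<m}" "j \<in> {..<m}" "i < j"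
    thus "\<bar>x i - x j\<bar> = x j - x i"
      using strict_mono_onD[OF assms, of i j] by simp
  qed
  finally show ?thesis ..
qed

section \<open>Sums of maximal minors\<close>

text \<open>For a set \<open>X\<close> of \<open>m\<close> variables this is the sum of the Schur functions \<open>s\<^sub>\<lambda>(X)\<close> over the partitions
  \<open>\<lambda>\<close> with at most \<open>m\<close> parts, all at most \<open>n - m\<close>, and it is 0 for \<open>n < m\<close>.  The recursion is the
  expansion of the alternants along the exponent \<open>n\<close>, divided by the Vandermonde determinant; the
  division makes it free of signs and symmetric in \<open>X\<close>.\<close>
primrec schur_sum :: "nat \<Rightarrow> real set \<Rightarrow> real" where
  "schur_sum 0 X = (if X = {} then 1 else 0)"
| "schur_sum (Suc n) X = schur_sum n X +
     (\<Sum>x\<in>X. x ^ n / (\<Prod>y\<in>X - {x}. x - y) * schur_sum n (X - {x}))"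

definition subsets :: "nat \<Rightarrow> nat \<Rightarrow> nat set set" where
  "subsets n m = {L. L \<subseteq> {..<n} \<and> card L = m}"

lemma finite_subsets [simp]: "finite (subsets n m)"
  by (rule finite_subset[of _ "Pow {..<n}"]) (auto simp: subsets_def)

lemma subsets_Suc_Suc:
  "subsets (Suc n) (Suc m) = subsets n (Suc m) \<union> insert n ` subsets n m"
  "subsets n (Suc m) \<inter> insert n ` subsets n m = {}"
  "inj_on (insert n) (subsets n m)"
proof -
  show "subsets (Suc n) (Suc m) = subsets n (Suc m) \<union> insert n ` subsets n m"
  proof (intro equalityI subsetI)
    fix L assume L: "L \<in> subsets (Suc n) (Suc m)"
    show "L \<in> subsets n (Suc m) \<union> insert n ` subsets n m"
    proof (cases "n \<in> L")
      case True
      hence "L = insert n (L - {n})" "L - {n} \<in> subsets n m"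
        using L by (auto simp: subsets_def less_Suc_eq)
      thus ?thesis by blast
    qed (use L in \<open>auto simp: subsets_def less_Suc_eq\<close>)
  next
    fix L assume "L \<in> subsets n (Suc m) \<union> insert n ` subsets n m"
    thus "L \<in> subsets (Suc n) (Suc m)"
    proof
      assume "L \<in> insert n ` subsets n m"
      then obtain K where K: "K \<subseteq> {..<n}" "card K = m" "L = insert n K"
        by (auto simp: subsets_def)
      hence "finite K" "n \<notin> K" using finite_subset by auto
      thus ?thesis using K by (auto simp: subsets_def)
    qed (auto simp: subsets_def)
  qed
  show "subsets n (Suc m) \<inter> insert n ` subsets n m = {}"
    by (auto simp: subsets_def)
  show "inj_on (insert n) (subsets n m)"
  proof (rule inj_onI)
    fix K L assume "K \<in> subsets n m" "L \<in> subsets n m" "insert n K = insert n L"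
    moreover from this have "n \<notin> K" "n \<notin> L" by (auto simp: subsets_def)
    ultimately show "K = L" by (simp add: insert_ident)
  qed
qed

definition minor_sum :: "nat \<Rightarrow> nat \<Rightarrow> (nat \<Rightarrow> real) \<Rightarrow> real" where
  "minor_sum n m x =
     (\<Sum>L\<in>subsets n m. det (mat m m (\<lambda>(i, j). x i ^ (sorted_list_of_set L ! j))))"

lemma sorted_list_of_set_insert_max:
  fixes L :: "nat set"
  assumes "L \<subseteq> {..<n}"
  shows "sorted_list_of_set (insert n L) = sorted_list_of_set L @ [n]"
proof -
  have "finite L" "n \<notin> L" using assms finite_subset by auto
  thus ?thesis
    by (intro sorted_list_of_set_unique[THEN iffD1])
       (use assms in \<open>auto simp: sorted_wrt_append\<close>)
qed

text \<open>A subset of \<open>{..<n + 1}\<close> either avoids \<open>n\<close> or has it as its largest element; in the latter case the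
  minor is expanded along its last column.\<close>
lemma minor_sum_Suc:
  "minor_sum (Suc n) (Suc m) x = minor_sum n (Suc m) x +
     (\<Sum>i<Suc m. x i ^ n * (-1) ^ (i + m) * minor_sum n m (\<lambda>j. x (insert_index i j)))"
proof -
  have "det (mat (Suc m) (Suc m) (\<lambda>(i, j). x i ^ (sorted_list_of_set (insert n L) ! j))) =
      (\<Sum>i<Suc m. x i ^ n * (-1) ^ (i + m) *
         det (mat m m (\<lambda>(i', j). x (insert_index i i') ^ (sorted_list_of_set L ! j))))"
    if "L \<in> subsets n m" for L
  proof -
    from that have L: "L \<subseteq> {..<n}" "card L = m" by (auto simp: subsets_def)
    hence len: "length (sorted_list_of_set L) = m" by simp
    have "(mat m m (\<lambda>(i', j). x (insert_index i i') ^ ((sorted_list_of_set L @ [n]) ! j))) =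
      (mat m m (\<lambda>(i', j). x (insert_index i i') ^ (sorted_list_of_set L ! j)))" for i
      using len by (intro eq_matI) (auto simp: nth_append)
    moreover have "(sorted_list_of_set L @ [n]) ! m = n"
      by (metis len nth_append_length)
    ultimately show ?thesis
      unfolding sorted_list_of_set_insert_max[OF L(1)]
      by (subst det_last_column) (simp del: sum.lessThan_Suc)
  qed
  hence "(\<Sum>L\<in>insert n ` subsets n m.
            det (mat (Suc m) (Suc m) (\<lambda>(i, j). x i ^ (sorted_list_of_set L ! j)))) =
     (\<Sum>i<Suc m. x i ^ n * (-1) ^ (i + m) * minor_sum n m (\<lambda>j. x (insert_index i j)))"
    by (simp add: sum.reindex[OF subsets_Suc_Suc(3)] minor_sum_def sum_distrib_left del: sum.lessThan_Suc)
       (rule sum.swap)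
  thus ?thesis
    by (simp add: minor_sum_def subsets_Suc_Suc(1) sum.union_disjoint[OF _ _ subsets_Suc_Suc(2)]
        del: sum.lessThan_Suc)
qed

lemma minor_sum_eq_schur_sum:
  assumes "inj_on x {..<m}"
  shows "minor_sum n m x = vandermonde m x * schur_sum n (x ` {..<m})"
  using assms
proof (induction n arbitrary: m x)
  case 0
  have "subsets 0 m = (if m = 0 then {{}} else {})" by (auto simp: subsets_def)
  thus ?case by (simp add: minor_sum_def vandermonde_def lessThan_empty_iff)
next
  case (Suc n)
  show ?case
  proof (cases m)
    case 0
    have "subsets n 0 = {{}}" for n by (auto simp: subsets_def dest: finite_subset)
    thus ?thesis using Suc.IH[of x 0] 0 by (simp add: minor_sum_def vandermonde_def)
  next
    case (Suc k)
    let ?X = "x ` {..<Suc k}"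
    have inj: "inj_on x {..<Suc k}" using Suc Suc.prems by simp
    have "x i ^ n * (-1) ^ (i + k) * minor_sum n k (\<lambda>j. x (insert_index i j)) =
       vandermonde (Suc k) x *
         (x i ^ n / (\<Prod>y\<in>?X - {x i}. x i - y) * schur_sum n (?X - {x i}))" if i: "i < Suc k" for i
    proof -
      have "(\<Prod>j\<in>{..<Suc k} - {i}. x i - x j) \<noteq> 0"
        using inj i by (auto simp: inj_on_def)
      thus ?thesis
        using Suc.IH[OF inj_on_skip(1)[OF inj i]]
        by (simp only: vandermonde_skip[OF i] prod_image_remove[OF inj i] inj_on_skip(2)[OF inj i])
           (simp add: field_simps)
    qed
    hence "minor_sum (Suc n) (Suc k) x = vandermonde (Suc k) x * schur_sum n ?X +
        vandermonde (Suc k) x *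
        (\<Sum>i<Suc k. x i ^ n / (\<Prod>y\<in>?X - {x i}. x i - y) * schur_sum n (?X - {x i}))"
      by (simp add: minor_sum_Suc Suc.IH[OF inj] sum_distrib_left del: sum.lessThan_Suc)
    also have "\<dots> = vandermonde (Suc k) x * schur_sum (Suc n) ?X"
      by (simp add: sum.reindex[OF inj] distrib_left del: sum.lessThan_Suc)
    finally show ?thesis using Suc by simp
  qed
qed

section \<open>Inverting a subset of the variables\<close>

definition flip :: "real set \<Rightarrow> real \<Rightarrow> real" where
  "flip S x = (if x \<in> S then 1 / x else x)"

text \<open>The factors that, together with the Vandermonde product, make up the Weyl denominator of type B,
  up to a monomial.\<close>
definition weyl_factor :: "real set \<Rightarrow> (real \<Rightarrow> real) \<Rightarrow> real" where
  "weyl_factor X y = (\<Prod>x\<in>X. 1 - y x) * (\<Prod>(a, b)\<in>pairs X. 1 - y a * y b)"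

lemma weyl_factor_cong:
  assumes "\<And>x. x \<in> X \<Longrightarrow> y x = z x"
  shows "weyl_factor X y = weyl_factor X z"
  unfolding weyl_factor_def using assms
  by (intro arg_cong2[of _ _ _ _ "(*)"] prod.cong prod_pairs_cong) auto

lemma weyl_factor_remove:
  assumes "finite X" "x \<in> X"
  shows "weyl_factor X y = weyl_factor (X - {x}) y * ((1 - y x) * (\<Prod>z\<in>X - {x}. 1 - y x * y z))"
  unfolding weyl_factor_def using assms
  by (subst prod_pairs_remove[of X x]) (auto simp: prod.remove[of X x] mult_ac)

lemma flip_mult_neq_1:
  assumes "X \<subseteq> {0<..<1}" "a \<in> X" "b \<in> X" "a \<noteq> b"
  shows "flip S a * flip S b \<noteq> 1"
proof -
  have ab: "0 < a" "a < 1" "0 < b" "b < 1" using assms by auto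
  hence "a * b < 1" using mult_strict_mono[of a 1 b 1] by simp
  thus ?thesis using ab assms(4) by (auto simp: flip_def field_simps)
qed

lemma weyl_factor_flip_nonzero:
  assumes "finite X" "X \<subseteq> {0<..<1}"
  shows "weyl_factor X (flip S) \<noteq> 0"
proof -
  have "flip S x \<noteq> 1" if "x \<in> X" for x using that assms by (auto simp: flip_def)
  moreover have "(\<Prod>(a, b)\<in>pairs X. 1 - flip S a * flip S b) \<noteq> 0"
    using flip_mult_neq_1[OF assms(2), of _ _ S] finite_pairs[OF assms(1)]
    by (force simp: prod_zero_iff pairs_def)
  ultimately show ?thesis
    using assms(1) by (auto simp: weyl_factor_def)
qed

text \<open>Interpolate \<open>p(t) = \<Prod>\<^sub>w (1 - t w)\<close> at the nodes \<open>Z\<close>, 0 and -1.  There are two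
  more nodes than the degree of \<open>p\<close>, so the Lagrange sum vanishes.  The node \<open>z\<close> contributes the factor \<open>1 - z\<^sup>2\<close>, of which the
  node -1 cancels \<open>1 + z\<close>; the nodes 0 and -1 themselves give the right-hand side.\<close>
lemma partial_fraction_inverted:
  fixes Z :: "real set"
  assumes "finite Z" "Z \<noteq> {}" "\<And>z. z \<in> Z \<Longrightarrow> z > 0"
  shows "(\<Sum>z\<in>Z. (1 - z) * (\<Prod>w\<in>Z - {z}. w * (1 - z * w) / (w - z))) = 1 - \<Prod>Z"
proof -
  define p where "p = (\<Prod>w\<in>Z. [:1, - w:])"
  define e :: real where "e = (-1) ^ card Z"
  have poly_p: "poly p t = (\<Prod>w\<in>Z. 1 - t * w)" for t
    by (simp add: p_def poly_prod)
  have "degree p \<le> (\<Sum>w\<in>Z. degree [:1, - w:])"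
    unfolding p_def using assms(1) by (rule degree_prod_sum_le[unfolded o_def])
  also have "\<dots> \<le> (\<Sum>w\<in>Z. 1)" by (rule sum_mono) simp
  finally have deg: "degree p \<le> card Z" by simp
  let ?A = "insert 0 (insert (- 1) Z)"
  have Z0: "0 \<notin> Z" using assms(3)[of 0] by blast
  have "- 1 \<notin> Z" using assms(3)[of "- 1"] by linarith
  note Z0 = Z0 this
  hence card: "card ?A = Suc (Suc (card Z))" using assms(1) by simp
  have "(\<Sum>a\<in>?A. poly p a / (\<Prod>b\<in>?A - {a}. a - b)) = coeff p (card ?A - 1)"
    using deg card assms(1) by (intro lagrange_top_coeff) auto
  also have "\<dots> = 0" using deg card by (intro coeff_eq_0) auto
  finally have "0 = poly p 0 / (\<Prod>b\<in>?A - {0}. 0 - b) +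
     (poly p (- 1) / (\<Prod>b\<in>?A - {- 1}. - 1 - b) +
      (\<Sum>a\<in>Z. poly p a / (\<Prod>b\<in>?A - {a}. a - b)))"
    using Z0 assms(1) by simp
  also have "poly p 0 / (\<Prod>b\<in>?A - {0}. 0 - b) = e / \<Prod>Z"
  proof -
    have "?A - {0} = insert (- 1) Z" using Z0 by auto
    thus ?thesis using Z0 assms(1)
      by (simp add: poly_p prod_uminus e_def minus_one_power_iff)
  qed
  also have "poly p (- 1) / (\<Prod>b\<in>?A - {- 1}. - 1 - b) = - e"
  proof -
    have A: "?A - {- 1} = insert 0 Z" using Z0 by auto
    define E where "E = (\<Prod>b\<in>Z. 1 + b)"
    have "E > 0" unfolding E_def using assms(3) by (intro prod_pos) force
    have "(\<Prod>b\<in>Z. - 1 - b) = (\<Prod>b\<in>Z. - 1 * (1 + b))" by (intro prod.cong) auto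
    also have "\<dots> = e * E" by (subst prod.distrib) (simp add: e_def E_def)
    finally have "(\<Prod>b\<in>insert 0 Z. - 1 - b) = - 1 * (e * E)"
      using Z0 assms(1) by simp
    moreover have "poly p (- 1) = E" by (simp add: poly_p E_def)
    ultimately show ?thesis unfolding A using \<open>E > 0\<close>
      by (simp add: e_def minus_one_power_iff)
  qed
  also have "(\<Sum>a\<in>Z. poly p a / (\<Prod>b\<in>?A - {a}. a - b)) =
     - e / \<Prod>Z * (\<Sum>z\<in>Z. (1 - z) * (\<Prod>w\<in>Z - {z}. w * (1 - z * w) / (w - z)))"
    unfolding sum_distrib_left
  proof (rule sum.cong)
    fix z assume z: "z \<in> Z"
    have A: "?A - {z} = insert 0 (insert (- 1) (Z - {z}))" using Z0 z by auto
    have "z > 0" using assms z by auto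
    have "(\<Prod>b\<in>?A - {z}. z - b) = z * ((z + 1) * (\<Prod>w\<in>Z - {z}. - 1 * (w - z)))"
      unfolding A using Z0 assms(1) by simp
    also have "(\<Prod>w\<in>Z - {z}. - 1 * (w - z)) = - e * (\<Prod>w\<in>Z - {z}. w - z)"
    proof -
      have "card Z = Suc (card (Z - {z}))" using z assms(1) by (metis card.remove)
      thus ?thesis by (subst prod.distrib) (simp add: e_def)
    qed
    finally have 1: "(\<Prod>b\<in>?A - {z}. z - b) = z * ((z + 1) * (- e * (\<Prod>w\<in>Z - {z}. w - z)))" .
    have 2: "poly p z = (1 - z * z) * (\<Prod>w\<in>Z - {z}. 1 - z * w)"
      unfolding poly_p using z assms(1) by (simp add: prod.remove)
    have 3: "\<Prod>Z = z * (\<Prod>w\<in>Z - {z}. w)"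
      using z assms(1) by (simp add: prod.remove)
    have "(\<Prod>w\<in>Z - {z}. w) \<noteq> 0" "(\<Prod>w\<in>Z - {z}. w - z) \<noteq> 0"
      using assms Z0 by auto
    moreover have "e * e = 1" by (simp add: e_def flip: power_mult_distrib)
    moreover have "1 - z * z = (1 + z) * (1 - z)" by (simp add: algebra_simps)
    ultimately show "poly p z / (\<Prod>b\<in>?A - {z}. z - b) =
        - e / \<Prod>Z * ((1 - z) * (\<Prod>w\<in>Z - {z}. w * (1 - z * w) / (w - z)))"
      unfolding 1 2 3 prod_dividef prod.distrib using \<open>z > 0\<close>
      by (simp add: divide_simps) (auto simp: e_def minus_one_power_iff algebra_simps)
  qed simp
  finally have eq: "0 = e / \<Prod>Z + (- e + - e / \<Prod>Z *
      (\<Sum>z\<in>Z. (1 - z) * (\<Prod>w\<in>Z - {z}. w * (1 - z * w) / (w - z))))" (is "0 = _ + (_ + _ * ?S)") .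
  have "\<Prod>Z \<noteq> 0" using assms Z0 by simp
  hence "e / \<Prod>Z * ?S = e / \<Prod>Z * (1 - \<Prod>Z)"
    using eq unfolding right_diff_distrib by simp
  moreover have "e / \<Prod>Z \<noteq> 0" using assms Z0 by (simp add: e_def)
  ultimately show ?thesis unfolding mult_cancel_left by blast
qed

text \<open>The value of \<open>schur_sum\<close> as an sum over the sets \<open>S\<close> of variables that are replaced
  by their inverses; for one variable it is the closed form
  \<open>1/(1 - x) + x ^ (n - 1)/(1 - 1/x)\<close> of a geometric sum.\<close>
definition flip_sum :: "nat \<Rightarrow> real set \<Rightarrow> real" where
  "flip_sum n X = (\<Sum>S\<in>Pow X. (\<Prod>x\<in>S. x ^ n / x ^ card X) / weyl_factor X (flip S))"

text \<open>This is the recursion of \<open>schur_sum\<close>, restricted to the terms of \<open>flip_sum\<close> that lead to a given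
  set \<open>S\<close> of inverted variables; \<open>x\<close> is removed from \<open>X\<close> and from \<open>S\<close> at once.  The variables outside \<open>S\<close>
  cancel, since \<open>x - y = x (1 - y/x)\<close>, and what remains is \<open>partial_fraction_inverted\<close> for the
  inverses of the elements of \<open>S\<close>.\<close>
lemma flip_term_recursion:
  assumes X: "finite X" "X \<subseteq> {0<..<1}" and S: "S \<subseteq> X"
  shows "(\<Sum>x\<in>S. x ^ n / (\<Prod>y\<in>X - {x}. x - y) *
            ((\<Prod>y\<in>S - {x}. y ^ n / y ^ (card X - 1)) / weyl_factor (X - {x}) (flip (S - {x})))) =
         (\<Prod>x\<in>S. x ^ n / x ^ card X) / weyl_factor X (flip S) * (\<Prod>S - 1)"
proof (cases "S = {}")
  case False
  have finS: "finite S" using X S finite_subset by auto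
  have pos: "0 < x" "x < 1" if "x \<in> X" for x using X that by auto
  define m where "m = card X"
  define P where "P = (\<Prod>x\<in>S. x ^ n / x ^ m)"
  have mpos: "card X = Suc (m - 1)" 
  proof -
    have "X \<noteq> {}" using False S by auto
    hence "card X > 0" using X(1) by (simp add: card_gt_0_iff)
    thus ?thesis by (simp add: m_def)
  qed
  \<comment> \<open>The summand of the partial fraction identity at the node \<open>1/x\<close>.\<close>
  define T where "T x = (1 - 1 / x) * (\<Prod>y\<in>S - {x}. 1 / y * (1 - 1 / x * (1 / y)) / (1 / y - 1 / x))" for x
  have "x ^ n / (\<Prod>y\<in>X - {x}. x - y) *
            ((\<Prod>y\<in>S - {x}. y ^ n / y ^ (card X - 1)) / weyl_factor (X - {x}) (flip (S - {x})))
      = P / weyl_factor X (flip S) * (\<Prod>S * T x)" if x: "x \<in> S" for x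
  proof -
    have xX: "x \<in> X" and x01: "0 < x" "x < 1" using x S pos by auto
    have fin: "finite (X - S)" "finite (S - {x})" using X finS by auto
    have split: "X - {x} = (X - S) \<union> (S - {x})" "(X - S) \<inter> (S - {x}) = {}"
      using x S by auto
    define Q where "Q = weyl_factor (X - {x}) (flip (S - {x}))"
    have Qeq: "weyl_factor (X - {x}) (flip S) = Q"
      unfolding Q_def by (rule weyl_factor_cong) (auto simp: flip_def)
    have Q0: "Q \<noteq> 0"
      unfolding Q_def using X by (intro weyl_factor_flip_nonzero) auto
    have D: "weyl_factor X (flip S) = Q * ((1 - 1 / x) *
        ((\<Prod>y\<in>X - S. 1 - y / x) * (\<Prod>y\<in>S - {x}. 1 - 1 / x * (1 / y))))"
    proof -
      have "(\<Prod>z\<in>X - {x}. 1 - flip S x * flip S z) =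
          (\<Prod>y\<in>X - S. 1 - y / x) * (\<Prod>y\<in>S - {x}. 1 - 1 / x * (1 / y))"
        unfolding split(1) prod.union_disjoint[OF fin split(2)]
        using x by (intro arg_cong2[of _ _ _ _ "(*)"] prod.cong) (auto simp: flip_def)
      thus ?thesis
        by (simp add: weyl_factor_remove[OF X(1) xX] Qeq flip_def[of S x] x)
    qed
    have D0: "weyl_factor X (flip S) \<noteq> 0" by (rule weyl_factor_flip_nonzero) fact+
    define c where "c = card (S - {x})"
    have cm: "m - 1 = card (X - S) + c"
      using card_Un_disjoint[OF fin split(2), folded split(1)] xX X(1) by (simp add: c_def m_def)
    have V: "(\<Prod>y\<in>X - {x}. x - y) = x ^ card (X - S) * (\<Prod>y\<in>X - S. 1 - y / x) * (\<Prod>y\<in>S - {x}. x - y)"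
    proof -
      have "(\<Prod>y\<in>X - S. x - y) = (\<Prod>y\<in>X - S. x * (1 - y / x))"
        using x01 by (intro prod.cong) (auto simp: field_simps)
      thus ?thesis unfolding split(1) prod.union_disjoint[OF fin split(2)]
        by (simp add: prod.distrib)
    qed
    have V0: "(\<Prod>y\<in>X - {x}. x - y) \<noteq> 0" using X by auto
    have Tx: "T x = (1 - 1 / x) * (x ^ c * (\<Prod>y\<in>S - {x}. 1 - 1 / x * (1 / y)) / (\<Prod>y\<in>S - {x}. x - y))"
    proof -
      have "(\<Prod>y\<in>S - {x}. 1 / y * (1 - 1 / x * (1 / y)) / (1 / y - 1 / x)) =
         (\<Prod>y\<in>S - {x}. x * (1 - 1 / x * (1 / y)) / (x - y))"
      proof (rule prod.cong)
        fix y assume "y \<in> S - {x}"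
        hence "y > 0" "y \<noteq> x" using S pos by auto
        thus "1 / y * (1 - 1 / x * (1 / y)) / (1 / y - 1 / x) = x * (1 - 1 / x * (1 / y)) / (x - y)"
          using x01 by (simp add: divide_simps)
      qed simp
      thus ?thesis by (simp add: T_def prod_dividef prod.distrib c_def)
    qed
    have PS: "P * \<Prod>S = x ^ n / x ^ (m - 1) * (\<Prod>y\<in>S - {x}. y ^ n / y ^ (m - 1))"
    proof -
      have "P * \<Prod>S = (\<Prod>y\<in>S. y ^ n / y ^ m * y)"
        unfolding P_def by (simp only: prod.distrib)
      also have "\<dots> = (\<Prod>y\<in>S. y ^ n / y ^ (m - 1))"
      proof (rule prod.cong)
        fix y assume "y \<in> S"
        hence "y > 0" using S pos by auto
        moreover have "y ^ m = y ^ (m - 1) * y"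
          using mpos unfolding m_def[symmetric] by (metis power_Suc2)
        ultimately show "y ^ n / y ^ m * y = y ^ n / y ^ (m - 1)" by simp
      qed simp
      also have "\<dots> = x ^ n / x ^ (m - 1) * (\<Prod>y\<in>S - {x}. y ^ n / y ^ (m - 1))"
        using x finS by (simp add: prod.remove)
      finally show ?thesis .
    qed
    define A where "A = (\<Prod>y\<in>X - S. 1 - y / x)"
    define B where "B = (\<Prod>y\<in>S - {x}. 1 - 1 / x * (1 / y))"
    define C where "C = (\<Prod>y\<in>S - {x}. x - y)"
    define R where "R = (\<Prod>y\<in>S - {x}. y ^ n / y ^ (m - 1))"
    note D = D[folded A_def B_def] and V = V[folded A_def C_def]
      and Tx = Tx[folded B_def C_def] and PS = PS[folded R_def]
    have nz: "A \<noteq> 0" "B \<noteq> 0" "C \<noteq> 0" "1 - 1 / x \<noteq> 0"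
      using D0 V0 unfolding D V by auto
    have "P / weyl_factor X (flip S) * (\<Prod>S * T x) = (P * \<Prod>S) * T x / weyl_factor X (flip S)"
      by simp
    also have "\<dots> = x ^ n / (\<Prod>y\<in>X - {x}. x - y) * (R / Q)"
    proof -
      define h where "h = 1 - 1 / x"
      have "x ^ c > 0" "x ^ card (X - S) > 0" using x01 by simp_all
      thus ?thesis unfolding PS Tx V D cm power_add using nz Q0 x01
        unfolding h_def[symmetric] by (simp only: divide_simps) simp
    qed
    finally show ?thesis by (simp add: Q_def m_def R_def)
  qed
  hence "(\<Sum>x\<in>S. x ^ n / (\<Prod>y\<in>X - {x}. x - y) *
            ((\<Prod>y\<in>S - {x}. y ^ n / y ^ (card X - 1)) / weyl_factor (X - {x}) (flip (S - {x})))) =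
      P / weyl_factor X (flip S) * (\<Prod>S * (\<Sum>x\<in>S. T x))"
    by (simp add: sum_distrib_left)
  also have "(\<Sum>x\<in>S. T x) = 1 - (\<Prod>x\<in>S. 1 / x)"
  proof -
    let ?i = "\<lambda>x::real. 1 / x"
    have inj: "inj_on ?i S" by (auto simp: inj_on_def)
    have "(\<Sum>x\<in>S. T x) = (\<Sum>z\<in>?i ` S. (1 - z) * (\<Prod>w\<in>?i ` S - {z}. w * (1 - z * w) / (w - z)))"
    proof (subst sum.reindex[OF inj], rule sum.cong)
      fix x assume "x \<in> S"
      have "?i ` S - {1 / x} = ?i ` (S - {x})" using \<open>x \<in> S\<close> by (auto simp: inj_on_def)
      moreover have "inj_on ?i (S - {x})" by (auto simp: inj_on_def)
      ultimately show "T x = ((\<lambda>z. (1 - z) * (\<Prod>w\<in>?i ` S - {z}. w * (1 - z * w) / (w - z))) \<circ> ?i) x"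
        by (simp only: o_def prod.reindex T_def)
    qed simp
    also have "\<dots> = 1 - \<Prod>(?i ` S)"
      using False finS S pos by (intro partial_fraction_inverted) auto
    also have "\<Prod>(?i ` S) = (\<Prod>x\<in>S. 1 / x)" by (simp only: prod.reindex[OF inj] o_def id_apply)
    finally show ?thesis .
  qed
  also have "\<Prod>S * (1 - (\<Prod>x\<in>S. 1 / x)) = \<Prod>S - 1"
  proof -
    have "\<Prod>S \<noteq> 0" using S pos by (auto simp: prod_zero_iff finS)
    thus ?thesis by (simp add: prod_dividef field_simps)
  qed
  finally show ?thesis by (simp add: P_def m_def)
qed simp

text \<open>Interchange the sums over \<open>x\<close> and over the subsets of \<open>X - {x}\<close>, indexing by \<open>S\<close>, the subset with \<open>x\<close>
  added.\<close>
lemma flip_sum_Suc: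
  assumes X: "finite X" "X \<subseteq> {0<..<1}"
  shows "flip_sum (Suc n) X = flip_sum n X +
     (\<Sum>x\<in>X. x ^ n / (\<Prod>y\<in>X - {x}. x - y) * flip_sum n (X - {x}))"
proof -
  define c where "c S = (\<Prod>x\<in>S. x ^ n / x ^ card X) / weyl_factor X (flip S)" for S
  define t where "t x S = x ^ n / (\<Prod>y\<in>X - {x}. x - y) *
     ((\<Prod>y\<in>S - {x}. y ^ n / y ^ (card X - 1)) / weyl_factor (X - {x}) (flip (S - {x})))" for x S
  have "(\<Sum>x\<in>X. x ^ n / (\<Prod>y\<in>X - {x}. x - y) * flip_sum n (X - {x})) =
     (\<Sum>x\<in>X. \<Sum>S\<in>{S\<in>Pow X. x \<in> S}. t x S)"
  proof (rule sum.cong)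
    fix x assume x: "x \<in> X"
    have "(\<Sum>S\<in>{S\<in>Pow X. x \<in> S}. t x S) = (\<Sum>T\<in>Pow (X - {x}). t x (insert x T))"
      by (rule sum.reindex_bij_witness[of _ "insert x" "\<lambda>S. S - {x}"]) (use x in \<open>auto simp: insert_absorb\<close>)
    also have "\<dots> = (\<Sum>T\<in>Pow (X - {x}). x ^ n / (\<Prod>y\<in>X - {x}. x - y) *
        ((\<Prod>y\<in>T. y ^ n / y ^ card (X - {x})) / weyl_factor (X - {x}) (flip T)))"
    proof (rule sum.cong)
      fix T assume "T \<in> Pow (X - {x})"
      hence "insert x T - {x} = T" by auto
      thus "t x (insert x T) = x ^ n / (\<Prod>y\<in>X - {x}. x - y) *
        ((\<Prod>y\<in>T. y ^ n / y ^ card (X - {x})) / weyl_factor (X - {x}) (flip T))"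
        using x X(1) by (simp add: t_def)
    qed simp
    finally show "x ^ n / (\<Prod>y\<in>X - {x}. x - y) * flip_sum n (X - {x}) =
        (\<Sum>S\<in>{S\<in>Pow X. x \<in> S}. t x S)"
      by (simp only: flip_sum_def sum_distrib_left)
  qed simp
  also have "\<dots> = (\<Sum>S\<in>Pow X. \<Sum>x\<in>{x\<in>X. x \<in> S}. t x S)"
    using X(1) by (intro sum.swap_restrict) auto
  also have "\<dots> = (\<Sum>S\<in>Pow X. c S * (\<Prod>S - 1))"
  proof (rule sum.cong)
    fix S assume "S \<in> Pow X"
    hence S: "S \<subseteq> X" "{x\<in>X. x \<in> S} = S" by auto
    show "(\<Sum>x\<in>{x\<in>X. x \<in> S}. t x S) = c S * (\<Prod>S - 1)"
      unfolding S(2) t_def c_def by (rule flip_term_recursion[OF X S(1)])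
  qed simp
  also have "\<dots> = flip_sum (Suc n) X - flip_sum n X"
    by (simp add: flip_sum_def c_def sum_subtractf [symmetric] prod.distrib prod_dividef
        diff_divide_distrib left_diff_distrib right_diff_distrib mult_ac)
  finally show ?thesis by simp
qed

section \<open>Macdonald's bounded sum as a determinant\<close>

definition folded_det :: "nat \<Rightarrow> nat \<Rightarrow> (nat \<Rightarrow> real) \<Rightarrow> real" where
  "folded_det n m x = det (mat m m (\<lambda>(i, j). x i ^ j - x i ^ (n + m - 1 - j)))"

lemma det_rows_add:
  fixes f g :: "nat \<Rightarrow> nat \<Rightarrow> real"
  shows "det (mat m m (\<lambda>(i, j). f i j + g i j)) =
    (\<Sum>T\<in>Pow {..<m}. det (mat m m (\<lambda>(i, j). if i \<in> T then f i j else g i j)))"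
proof -
  have eq: "(\<Prod>i=0..<m. mat m m (\<lambda>(i, j). f i j + g i j) $$ (i, p i)) =
     (\<Sum>T\<in>Pow {..<m}. \<Prod>i=0..<m. mat m m (\<lambda>(i, j). if i \<in> T then f i j else g i j) $$ (i, p i))"
    if p: "p permutes {0..<m}" for p
  proof -
    have pm: "p i < m" if "i < m" for i using permutes_in_image[OF p, of i] that by simp
    have "(\<Prod>i=0..<m. mat m m (\<lambda>(i, j). f i j + g i j) $$ (i, p i)) =
        (\<Prod>i\<in>{..<m}. f i (p i) + g i (p i))"
      using pm by (intro prod.cong) auto
    also have "\<dots> = (\<Sum>T\<in>Pow {..<m}. (\<Prod>i\<in>T. f i (p i)) * (\<Prod>i\<in>{..<m} - T. g i (p i)))"
      by (rule prod_add) simp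
    also have "\<dots> = (\<Sum>T\<in>Pow {..<m}. \<Prod>i=0..<m.
        mat m m (\<lambda>(i, j). if i \<in> T then f i j else g i j) $$ (i, p i))"
    proof (rule sum.cong)
      fix T assume "T \<in> Pow {..<m}"
      hence T: "T \<subseteq> {..<m}" "{0..<m} = T \<union> ({..<m} - T)" "finite T" by (auto intro: finite_subset)
      show "(\<Prod>i\<in>T. f i (p i)) * (\<Prod>i\<in>{..<m} - T. g i (p i)) =
        (\<Prod>i=0..<m. mat m m (\<lambda>(i, j). if i \<in> T then f i j else g i j) $$ (i, p i))"
        unfolding T(2)
        by (subst prod.union_disjoint)
           (use T pm in \<open>auto intro!: arg_cong2[of _ _ _ _ "(*)"] prod.cong simp: subset_iff\<close>)
    qed simp
    finally show ?thesis .
  qed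
  have "det (mat m m (\<lambda>(i, j). f i j + g i j)) =
    (\<Sum>p\<in>{p. p permutes {0..<m}}. \<Sum>T\<in>Pow {..<m}. signof p *
       (\<Prod>i=0..<m. mat m m (\<lambda>(i, j). if i \<in> T then f i j else g i j) $$ (i, p i)))"
    unfolding det_def'[OF mat_carrier]
    by (intro sum.cong refl) (simp only: mem_Collect_eq eq sum_distrib_left)
  also have "\<dots> = (\<Sum>T\<in>Pow {..<m}. det (mat m m (\<lambda>(i, j). if i \<in> T then f i j else g i j)))"
    by (subst sum.swap, intro sum.cong refl, subst det_def'[of _ m]) auto
  finally show ?thesis .
qed

lemma inj_on_flip:
  assumes "X \<subseteq> {0<..<1}"
  shows "inj_on (flip S) X"
proof (rule inj_onI)
  fix a b assume ab: "a \<in> X" "b \<in> X" "flip S a = flip S b"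
  hence "0 < a" "a < 1" "0 < b" "b < 1" using assms by auto
  moreover from this have "1 < 1 / a" "1 < 1 / b" by simp_all
  ultimately show "a = b" using ab(3) by (auto simp: flip_def split: if_splits)
qed

lemma weyl_factor_image:
  fixes x :: "nat \<Rightarrow> real"
  assumes "inj_on x {..<m}"
  shows "weyl_factor (x ` {..<m}) y =
    (\<Prod>i<m. 1 - y (x i)) * (\<Prod>(i, j)\<in>pairs {..<m}. 1 - y (x i) * y (x j))"
  unfolding weyl_factor_def
  by (subst prod_pairs_image[OF finite_lessThan assms]) (auto simp: prod.reindex[OF assms] mult.commute)

text \<open>The quotient \<open>(y\<^sub>j - y\<^sub>i)(1 - y\<^sub>i y\<^sub>j) / (y\<^sub>i y\<^sub>j) = (1/y\<^sub>i + y\<^sub>i) - (1/y\<^sub>j + y\<^sub>j)\<close> does not change when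
  a variable is inverted, so that inverting variables only produces the powers \<open>w i\<close> and the
  factors \<open>1 - 1/x\<close>.\<close>
lemma vandermonde_flip:
  assumes inj: "inj_on x {..<m}" and X: "x ` {..<m} \<subseteq> {0<..<1}" and S: "S \<subseteq> x ` {..<m}"
  shows "(\<Prod>i<m. if x i \<in> S then - (x i ^ (n + m - 1)) else 1) * vandermonde m (\<lambda>i. flip S (x i)) =
    vandermonde m x * weyl_factor (x ` {..<m}) id *
      ((\<Prod>x\<in>S. x ^ n / x ^ m) / weyl_factor (x ` {..<m}) (flip S))"
proof -
  let ?y = "\<lambda>i. flip S (x i)"
  let ?I = "{..<m}"
  define w where "w i = ?y i / x i" for i
  have x01: "0 < x i" "x i < 1" if "i < m" for i using X that by auto
  have S0: "weyl_factor (x ` ?I) (flip S) \<noteq> 0" using X by (intro weyl_factor_flip_nonzero) auto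
  have pair: "(?y j - ?y i) * (1 - ?y i * ?y j) = (x j - x i) * (1 - x i * x j) * (w i * w j)"
    if "i < m" "j < m" for i j
    using x01[OF that(1)] x01[OF that(2)] by (simp add: flip_def w_def divide_simps) (simp add: algebra_simps)
  have "vandermonde m ?y * weyl_factor (x ` ?I) (flip S) =
      (\<Prod>(i, j)\<in>pairs ?I. (?y j - ?y i) * (1 - ?y i * ?y j)) * (\<Prod>i<m. 1 - ?y i)"
    by (simp only: vandermonde_def weyl_factor_image[OF inj] prod_pairs_distrib mult_ac)
  also have "(\<Prod>(i, j)\<in>pairs ?I. (?y j - ?y i) * (1 - ?y i * ?y j)) =
      (\<Prod>(i, j)\<in>pairs ?I. (x j - x i) * (1 - x i * x j) * (w i * w j))"
    by (rule prod_pairs_cong) (use pair in auto)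
  also have "\<dots> = vandermonde m x * (\<Prod>(i, j)\<in>pairs ?I. 1 - x i * x j) * (\<Prod>i<m. w i ^ (m - 1))"
    by (simp only: prod_pairs_distrib[of "\<lambda>i j. (x j - x i) * (1 - x i * x j)" "\<lambda>i j. w i * w j"]
        prod_pairs_distrib[of "\<lambda>i j. x j - x i" "\<lambda>i j. 1 - x i * x j"]
        prod_pairs_mult[OF finite_lessThan] vandermonde_def prod_power_distrib card_lessThan)
  finally have "(\<Prod>i<m. if x i \<in> S then - (x i ^ (n + m - 1)) else 1) *
      (vandermonde m ?y * weyl_factor (x ` ?I) (flip S)) =
      vandermonde m x * (\<Prod>(i, j)\<in>pairs ?I. 1 - x i * x j) *
      (\<Prod>i<m. (if x i \<in> S then - (x i ^ (n + m - 1)) else 1) * w i ^ (m - 1) * (1 - ?y i))"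
    by (simp add: prod.distrib mult_ac)
  also have "(\<Prod>i<m. (if x i \<in> S then - (x i ^ (n + m - 1)) else 1) * w i ^ (m - 1) * (1 - ?y i)) =
     (\<Prod>i<m. (1 - x i) * (if x i \<in> S then x i ^ n / x i ^ m else 1))"
  proof (rule prod.cong)
    fix i assume "i \<in> ?I"
    hence i: "0 < x i" "i < m" using x01 by auto
    then obtain k where k: "m = Suc k" by (cases m) auto
    show "(if x i \<in> S then - (x i ^ (n + m - 1)) else 1) * w i ^ (m - 1) * (1 - ?y i) =
      (1 - x i) * (if x i \<in> S then x i ^ n / x i ^ m else 1)"
      using i by (auto simp: k w_def flip_def power_add power_divide power_mult_distrib field_simps)
  qed simp
  also have "\<dots> = (\<Prod>i<m. 1 - x i) * (\<Prod>x\<in>S. x ^ n / x ^ m)"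
  proof -
    have "(\<Prod>i<m. if x i \<in> S then x i ^ n / x i ^ m else 1) =
      (\<Prod>y\<in>x ` ?I. if y \<in> S then y ^ n / y ^ m else 1)"
      using inj by (simp add: prod.reindex)
    also have "\<dots> = (\<Prod>y\<in>S. y ^ n / y ^ m)"
      using S by (simp add: prod.inter_restrict[symmetric] Int_absorb1)
    finally show ?thesis by (simp only: prod.distrib)
  qed
  finally show ?thesis
    using S0 by (simp add: weyl_factor_image[OF inj, of id] field_simps)
qed

lemma folded_det_eq_flip_sum:
  assumes inj: "inj_on x {..<m}" and X: "x ` {..<m} \<subseteq> {0<..<1}"
  shows "folded_det n m x =
    vandermonde m x * weyl_factor (x ` {..<m}) id * flip_sum n (x ` {..<m})"
proof -
  let ?X = "x ` {..<m}"
  have "folded_det n m x = det (mat m m (\<lambda>(i, j). - (x i ^ (n + m - 1 - j)) + x i ^ j))"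
    by (simp add: folded_det_def)
  also have "\<dots> = (\<Sum>T\<in>Pow {..<m}.
      det (mat m m (\<lambda>(i, j). if i \<in> T then - (x i ^ (n + m - 1 - j)) else x i ^ j)))"
    by (rule det_rows_add)
  also have "\<dots> = (\<Sum>T\<in>Pow {..<m}. (\<Prod>i<m. if x i \<in> x ` T then - (x i ^ (n + m - 1)) else 1) *
      vandermonde m (\<lambda>i. flip (x ` T) (x i)))"
  proof (rule sum.cong)
    fix T assume "T \<in> Pow {..<m}"
    hence mem: "x i \<in> x ` T \<longleftrightarrow> i \<in> T" if "i < m" for i
      using inj that by (auto simp: inj_on_def)
    let ?c = "\<lambda>i. if x i \<in> x ` T then - (x i ^ (n + m - 1)) else 1"
    have "mat m m (\<lambda>(i, j). if i \<in> T then - (x i ^ (n + m - 1 - j)) else x i ^ j) =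
       mat m m (\<lambda>(i, j). ?c i * 1 * flip (x ` T) (x i) ^ j)"
    proof (rule eq_matI)
      fix i j assume "i < dim_row (mat m m (\<lambda>(i, j). ?c i * 1 * flip (x ` T) (x i) ^ j))"
        "j < dim_col (mat m m (\<lambda>(i, j). ?c i * 1 * flip (x ` T) (x i) ^ j))"
      hence ij: "i < m" "j < m" by auto
      moreover have "x i > 0" using ij X by auto
      moreover have "x i ^ (n + m - 1) = x i ^ (n + m - 1 - j) * x i ^ j"
        using ij by (simp flip: power_add)
      ultimately show "mat m m (\<lambda>(i, j). if i \<in> T then - (x i ^ (n + m - 1 - j)) else x i ^ j) $$ (i, j) =
          mat m m (\<lambda>(i, j). ?c i * 1 * flip (x ` T) (x i) ^ j) $$ (i, j)"
        by (simp add: mem flip_def power_divide)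
    qed auto
    moreover have "inj_on (\<lambda>i. flip (x ` T) (x i)) {..<m}"
      using comp_inj_on[OF inj inj_on_flip[OF X]] by (simp add: o_def)
    ultimately show "det (mat m m (\<lambda>(i, j). if i \<in> T then - (x i ^ (n + m - 1 - j)) else x i ^ j)) =
        (\<Prod>i<m. ?c i) * vandermonde m (\<lambda>i. flip (x ` T) (x i))"
      using det_scale[of m ?c "\<lambda>_. 1" "\<lambda>i j. flip (x ` T) (x i) ^ j"]
      by (simp only: det_vandermonde prod.neutral_const mult_1_right)
  qed simp
  also have "\<dots> = (\<Sum>S\<in>Pow ?X. (\<Prod>i<m. if x i \<in> S then - (x i ^ (n + m - 1)) else 1) *
      vandermonde m (\<lambda>i. flip S (x i)))"
    using inj by (intro sum.reindex_bij_betw bij_betw_Pow) (simp add: bij_betw_def)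
  also have "\<dots> = vandermonde m x * weyl_factor ?X id * flip_sum n ?X"
    unfolding flip_sum_def sum_distrib_left card_image[OF inj] card_lessThan
    by (intro sum.cong refl vandermonde_flip inj X) auto
  finally show ?thesis .
qed

text \<open>For \<open>n = 0\<close> the columns \<open>j\<close> and \<open>m - 1 - j\<close> are negatives of each other.  This gives the initial
  value of the recursion.\<close>
lemma folded_det_0:
  assumes "m > 0"
  shows "folded_det 0 m x = 0"
proof -
  obtain k where k: "m = Suc k" using assms by (cases m) auto
  define A where "A = mat m m (\<lambda>(i, j). x i ^ j - x i ^ (0 + m - 1 - j))"
  have A: "A \<in> carrier_mat m m" by (simp add: A_def)
  have "det A = 0"
  proof (cases "k = 0")
    case True
    hence "A \<in> carrier_mat 1 1" using A k by simp
    hence "det A = A $$ (0, 0)" by (rule det_single)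
    thus ?thesis using True k by (simp add: A_def)
  next
    case False
    have "det (addcol 1 k 0 A) = det A"
      using False k A by (intro det_addcol) auto
    moreover have "det (addcol 1 k 0 A) = (\<Sum>i<m. addcol 1 k 0 A $$ (i, k) * cofactor (addcol 1 k 0 A) i k)"
      using A k by (intro laplace_expansion_column) auto
    moreover have "addcol 1 k 0 A $$ (i, k) = 0" if "i < m" for i
      using that k by (simp add: A_def mat_addcol_def)
    ultimately show ?thesis by simp
  qed
  thus ?thesis by (simp add: folded_det_def A_def)
qed

lemma weyl_factor_id_nonzero:
  assumes "finite X" "X \<subseteq> {0<..<1}"
  shows "weyl_factor X id > 0"
proof -
  have "a * b < 1" if "a \<in> X" "b \<in> X" for a b
  proof -
    have "0 < a" "a < 1" "0 < b" "b < 1" using assms that by auto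
    thus ?thesis using mult_strict_mono[of a 1 b 1] by simp
  qed
  thus ?thesis unfolding weyl_factor_def using assms(2)
    by (auto intro!: mult_pos_pos prod_pos simp: pairs_def)
qed

lemma vandermonde_nonzero:
  assumes "inj_on x {..<m}"
  shows "vandermonde m x \<noteq> 0"
  using assms finite_pairs[of "{..<m}"] unfolding vandermonde_def
  by (force simp: prod_zero_iff pairs_def inj_on_def)

lemma schur_sum_eq_flip_sum:
  assumes "finite X" "X \<subseteq> {0<..<1}"
  shows "schur_sum n X = flip_sum n X"
  using assms
proof (induction n arbitrary: X)
  case 0
  show ?case
  proof (cases "X = {}")
    case False
    obtain x where x: "bij_betw x {0..<card X} X"
      using ex_bij_betw_nat_finite[OF 0(1)] by blast
    hence inj: "inj_on x {..<card X}" and img: "x ` {..<card X} = X"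
      by (auto simp: bij_betw_def atLeast0LessThan)
    have "vandermonde (card X) x * weyl_factor X id * flip_sum 0 X = 0"
      using folded_det_eq_flip_sum[OF inj, of 0] folded_det_0[of "card X" x] 0 False
      by (simp add: img card_gt_0_iff)
    moreover have "vandermonde (card X) x \<noteq> 0" by (rule vandermonde_nonzero[OF inj])
    moreover have "weyl_factor X id > 0" by (rule weyl_factor_id_nonzero[OF 0])
    ultimately show ?thesis using False by simp
  qed (simp add: flip_sum_def weyl_factor_def)
next
  case (Suc n)
  have "schur_sum n (X - {x}) = flip_sum n (X - {x})" for x
    using Suc.prems by (intro Suc.IH) auto
  thus ?case using Suc by (simp add: flip_sum_Suc)
qed

text \<open>Macdonald's evaluation of the sum of the Schur functions in a box.\<close>
theorem folded_det_eq_minor_sum: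
  assumes inj: "inj_on x {..<m}" and X: "x ` {..<m} \<subseteq> {0<..<1}"
  shows "folded_det n m x = weyl_factor (x ` {..<m}) id * minor_sum n m x"
  using X by (simp add: folded_det_eq_flip_sum[OF inj] minor_sum_eq_schur_sum[OF inj] schur_sum_eq_flip_sum)

text \<open>For \<open>n = m\<close> only one minor is left, so that Macdonald's formula becomes the Weyl denominator formula
  of type B.\<close>
lemma minor_sum_full:
  assumes "inj_on x {..<m}"
  shows "minor_sum m m x = vandermonde m x"
proof -
  have "subsets m m = {{..<m}}"
    by (auto simp: subsets_def) (metis card_subset_eq card_lessThan finite_lessThan lessThan_iff)
  moreover have "mat m m (\<lambda>(i, j). x i ^ (sorted_list_of_set {..<m} ! j)) = mat m m (\<lambda>(i, j). x i ^ j)"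
    by (intro eq_matI) (auto simp: lessThan_atLeast0)
  ultimately show ?thesis
    using det_vandermonde[OF assms] by (simp add: minor_sum_def)
qed

section \<open>Principal specialisation\<close>

lemma det_vandermonde_reversed:
  fixes z :: "nat \<Rightarrow> real"
  assumes inj: "inj_on z {..<m}" and nz: "\<And>i. i < m \<Longrightarrow> z i \<noteq> 0"
  shows "det (mat m m (\<lambda>(i, j). z j ^ (m - 1 - i))) = (\<Prod>(i, j)\<in>pairs {..<m}. z i - z j)"
proof -
  have "inj_on (\<lambda>i. 1 / z i) {..<m}"
    using inj by (auto simp: inj_on_def)
  note vd = det_vandermonde[OF this]
  have "det (mat m m (\<lambda>(i, j). z j ^ (m - 1 - i))) =
      det (transpose_mat (mat m m (\<lambda>(i, j). z j ^ (m - 1 - i))))"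
    by (rule det_transpose[symmetric, of _ m]) simp
  also have "transpose_mat (mat m m (\<lambda>(i, j). z j ^ (m - 1 - i))) =
      mat m m (\<lambda>(i, j). z i ^ (m - 1) * 1 * (1 / z i) ^ j)"
  proof (rule eq_matI)
    fix i j assume "i < dim_row (mat m m (\<lambda>(i, j). z i ^ (m - 1) * 1 * (1 / z i) ^ j))"
      "j < dim_col (mat m m (\<lambda>(i, j). z i ^ (m - 1) * 1 * (1 / z i) ^ j))"
    hence ij: "i < m" "j < m" by auto
    moreover from ij have "z i ^ (m - 1) = z i ^ (m - 1 - j) * z i ^ j"
      by (simp flip: power_add)
    ultimately show "transpose_mat (mat m m (\<lambda>(i, j). z j ^ (m - 1 - i))) $$ (i, j) =
        mat m m (\<lambda>(i, j). z i ^ (m - 1) * 1 * (1 / z i) ^ j) $$ (i, j)"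
      using nz[of i] by (simp add: power_divide)
  qed auto
  also have "det \<dots> = (\<Prod>i<m. z i ^ (m - 1)) * vandermonde m (\<lambda>i. 1 / z i)"
    using det_scale[of m "\<lambda>i. z i ^ (m - 1)" "\<lambda>_. 1" "\<lambda>i j. (1 / z i) ^ j"]
    by (simp only: vd prod.neutral_const mult_1_right)
  also have "(\<Prod>i<m. z i ^ (m - 1)) = (\<Prod>(i, j)\<in>pairs {..<m}. z i * z j)"
    by (simp only: prod_pairs_mult[OF finite_lessThan] prod_power_distrib card_lessThan)
  also have "(\<Prod>(i, j)\<in>pairs {..<m}. z i * z j) * vandermonde m (\<lambda>i. 1 / z i) =
      (\<Prod>(i, j)\<in>pairs {..<m}. z i - z j)"
    unfolding vandermonde_def prod_pairs_distrib[symmetric]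
    by (rule prod_pairs_cong) (use nz in \<open>auto simp: field_simps\<close>)
  finally show ?thesis .
qed

lemma powr_prod:
  assumes "(q::real) > 0" "finite A"
  shows "(\<Prod>i\<in>A. q powr f i) = q powr (\<Sum>i\<in>A. f i)"
  using assms by (simp add: powr_sum)

lemma inj_powr:
  assumes "0 < (q::real)" "q < 1" "inj_on e A"
  shows "inj_on (\<lambda>i. q powr e i) A"
  using assms by (auto simp: inj_on_def powr_inj)

lemma inj_power:
  assumes "0 < (q::real)" "q < 1"
  shows "inj_on (\<lambda>i. q ^ i) (A :: nat set)"
  using assms by (auto intro!: inj_onI simp: power_inject_exp')

text \<open>With the variables in increasing order, the matrix of each minor is, after scaling columns, a
  transposed Vandermonde matrix in \<open>q\<^sup>l\<close> with its rows reversed.  As \<open>q\<^sup>l\<close> decreases with \<open>l\<close>, all its factors are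
  positive.\<close>
lemma minor_sum_geometric:
  assumes q: "0 < q" "q < 1"
  shows "minor_sum n m (\<lambda>i. q powr (real m - 1/2 - real i)) =
    (\<Sum>L\<in>subsets n m. (\<Prod>l\<in>L. q powr (real l / 2)) * vdm ((\<lambda>l. q ^ l) ` L))"
  unfolding minor_sum_def
proof (rule sum.cong)
  fix L assume "L \<in> subsets n m"
  hence fin: "finite L" and card: "card L = m" by (auto simp: subsets_def intro: finite_subset)
  define l where "l j = sorted_list_of_set L ! j" for j
  have len: "length (sorted_list_of_set L) = m" using card by simp
  have mono: "l i < l j" if "i < j" "j < m" for i j
    using strict_sorted_list_of_set[of L] that len unfolding l_def
    by (simp add: sorted_wrt_iff_nth_less)
  have img: "l ` {..<m} = L"
    using fin len set_conv_nth[of "sorted_list_of_set L"] by (auto simp: l_def)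
  have inj: "inj_on l {..<m}"
    by (rule linorder_inj_onI) (use mono in fastforce)+
  define z where "z j = q ^ l j" for j
  have injz: "inj_on z {..<m}"
    using comp_inj_on[OF inj inj_power[OF q]] by (simp add: o_def z_def[abs_def])
  have zimg: "z ` {..<m} = (\<lambda>l. q ^ l) ` L"
    by (simp add: z_def img[symmetric] image_image)
  have "mat m m (\<lambda>(i, j). (q powr (real m - 1/2 - real i)) ^ l j) =
      mat m m (\<lambda>(i, j). 1 * q powr (real (l j) / 2) * z j ^ (m - 1 - i))"
  proof (rule eq_matI)
    fix i j assume "i < dim_row (mat m m (\<lambda>(i, j). 1 * q powr (real (l j) / 2) * z j ^ (m - 1 - i)))"
      "j < dim_col (mat m m (\<lambda>(i, j). 1 * q powr (real (l j) / 2) * z j ^ (m - 1 - i)))"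
    hence ij: "i < m" "j < m" by auto
    have "(q powr (real m - 1/2 - real i)) ^ l j = q powr (real (l j) * (real m - 1/2 - real i))"
      using q by (simp add: powr_power mult.commute)
    also have "real (l j) * (real m - 1/2 - real i) = real (l j) / 2 + real (l j * (m - 1 - i))"
    proof -
      have "real (m - 1 - i) = real m - 1 - real i" using ij by (simp add: of_nat_diff)
      thus ?thesis by (simp only: of_nat_mult) (simp add: algebra_simps)
    qed
    also have "q powr \<dots> = q powr (real (l j) / 2) * z j ^ (m - 1 - i)"
      using q by (simp add: powr_add powr_realpow z_def power_mult del: of_nat_mult)
    finally show "mat m m (\<lambda>(i, j). (q powr (real m - 1/2 - real i)) ^ l j) $$ (i, j) =
      mat m m (\<lambda>(i, j). 1 * q powr (real (l j) / 2) * z j ^ (m - 1 - i)) $$ (i, j)"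
      using ij by simp
  qed auto
  hence "det (mat m m (\<lambda>(i, j). (q powr (real m - 1/2 - real i)) ^ l j)) =
      (\<Prod>j<m. q powr (real (l j) / 2)) * (\<Prod>(i, j)\<in>pairs {..<m}. z i - z j)"
    using det_vandermonde_reversed[OF injz] q
      det_scale[of m "\<lambda>_. 1" "\<lambda>j. q powr (real (l j) / 2)" "\<lambda>i j. z j ^ (m - 1 - i)"]
    by (simp add: z_def)
  also have "(\<Prod>j<m. q powr (real (l j) / 2)) = (\<Prod>l\<in>L. q powr (real l / 2))"
    unfolding img[symmetric] by (simp add: prod.reindex[OF inj])
  also have "(\<Prod>(i, j)\<in>pairs {..<m}. z i - z j) = vdm ((\<lambda>l. q ^ l) ` L)"
    unfolding zimg[symmetric] vdm_image[OF finite_lessThan injz]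
  proof (rule prod_pairs_cong)
    fix i j assume "i \<in> {..<m}" "j \<in> {..<m}" "i < j"
    hence "z j \<le> z i" unfolding z_def using mono[of i j] q by (intro power_decreasing) auto
    thus "z i - z j = \<bar>z i - z j\<bar>" by simp
  qed
  finally show "det (mat m m (\<lambda>(i, j). (q powr (real m - 1/2 - real i)) ^ (sorted_list_of_set L ! j))) =
     (\<Prod>l\<in>L. q powr (real l / 2)) * vdm ((\<lambda>l. q ^ l) ` L)"
    by (simp add: l_def)
qed simp

text \<open>With \<open>c = m - 1/2 - i\<close>, the entry \<open>q powr (c j) - q powr (c (p - j))\<close> equals
  \<open>q powr (c p/2) (u powr (- c) - u powr c)\<close> for \<open>u = q powr (p/2 - j)\<close>.  Scaling the column
  by \<open>u powr (m - 1/2)\<close> turns the bracket into \<open>u ^ i - u ^ (2 m - 1 - i)\<close>, an entry of the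
  transposed matrix with \<open>n = m\<close>.\<close>
lemma folded_det_geometric:
  fixes q :: real and n m :: nat
  assumes q: "0 < q" "q < 1" and m: "m > 0"
  defines "p \<equiv> real n + real m - 1"
  shows "folded_det n m (\<lambda>i. q powr (real m - 1/2 - real i)) =
    (\<Prod>i<m. q powr ((real m - 1/2 - real i) * p / 2)) *
    (\<Prod>j<m. q powr (- (p / 2 - real j) * (real m - 1/2))) *
    folded_det m m (\<lambda>j. q powr (p / 2 - real j))"
proof -
  define x where "x i = q powr (real m - 1/2 - real i)" for i :: nat
  define u where "u j = q powr (p / 2 - real j)" for j :: nat
  define a where "a i = q powr ((real m - 1/2 - real i) * p / 2)" for i :: nat
  define b where "b j = q powr (- (p / 2 - real j) * (real m - 1/2))" for j :: nat
  have "mat m m (\<lambda>(i, j). x i ^ j - x i ^ (n + m - 1 - j)) =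
      mat m m (\<lambda>(i, j). a i * b j * (u j ^ i - u j ^ (m + m - 1 - i)))"
  proof (rule eq_matI)
    fix i j assume "i < dim_row (mat m m (\<lambda>(i, j). a i * b j * (u j ^ i - u j ^ (m + m - 1 - i))))"
      "j < dim_col (mat m m (\<lambda>(i, j). a i * b j * (u j ^ i - u j ^ (m + m - 1 - i))))"
    hence ij: "i < m" "j < m" by auto
    define c where "c = real m - 1/2 - real i"
    have xk: "x i ^ k = q powr (c * real k)" for k
      using q by (simp add: x_def c_def powr_power mult.commute)
    have uk: "u j ^ k = q powr ((p / 2 - real j) * real k)" for k
      using q by (simp add: u_def powr_power mult.commute)
    have p': "real (n + m - 1 - j) = p - real j" using ij by (simp add: p_def of_nat_diff)
    have i': "real (m + m - 1 - i) = real m - 1/2 + c" using ij by (simp add: c_def of_nat_diff)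
    have "a i * b j * u j ^ i = q powr (c * p / 2 + - (p / 2 - real j) * (real m - 1/2) + (p / 2 - real j) * real i)"
      by (simp only: a_def b_def uk powr_add c_def)
    also have "c * p / 2 + - (p / 2 - real j) * (real m - 1/2) + (p / 2 - real j) * real i = c * real j"
      by (simp add: c_def field_simps)
    finally have 1: "a i * b j * u j ^ i = x i ^ j" by (simp only: xk)
    have "a i * b j * u j ^ (m + m - 1 - i) = q powr (c * p / 2 + - (p / 2 - real j) * (real m - 1/2) +
        (p / 2 - real j) * (real m - 1/2 + c))"
      by (simp only: a_def b_def uk powr_add c_def i')
    also have "c * p / 2 + - (p / 2 - real j) * (real m - 1/2) + (p / 2 - real j) * (real m - 1/2 + c) =
        c * (p - real j)"
      by (simp add: field_simps)
    finally have 2: "a i * b j * u j ^ (m + m - 1 - i) = x i ^ (n + m - 1 - j)" by (simp only: xk p')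
    show "mat m m (\<lambda>(i, j). x i ^ j - x i ^ (n + m - 1 - j)) $$ (i, j) =
      mat m m (\<lambda>(i, j). a i * b j * (u j ^ i - u j ^ (m + m - 1 - i))) $$ (i, j)"
      using ij 1 2 by (simp only: index_mat prod.case right_diff_distrib)
  qed auto
  hence "folded_det n m x = det (mat m m (\<lambda>(i, j). a i * b j * (u j ^ i - u j ^ (m + m - 1 - i))))"
    by (simp add: folded_det_def)
  also have "\<dots> = (\<Prod>i<m. a i) * (\<Prod>j<m. b j) * det (mat m m (\<lambda>(i, j). u j ^ i - u j ^ (m + m - 1 - i)))"
    by (rule det_scale)
  also have "det (mat m m (\<lambda>(i, j). u j ^ i - u j ^ (m + m - 1 - i))) = 
      det (transpose_mat (mat m m (\<lambda>(i, j). u j ^ i - u j ^ (m + m - 1 - i))))"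
    by (rule det_transpose[symmetric, of _ m]) simp
  also have "transpose_mat (mat m m (\<lambda>(i, j). u j ^ i - u j ^ (m + m - 1 - i))) =
      mat m m (\<lambda>(i, j). u i ^ j - u i ^ (m + m - 1 - j))"
    by (rule eq_matI) auto
  finally show ?thesis unfolding folded_det_def x_def u_def a_def b_def .
qed

text \<open>The value of \<open>weyl_factor\<close> at \<open>q powr ((r + 1)/2), q powr ((r + 3)/2), \<dots>\<close> (\<open>m\<close> terms).\<close>
definition box_denom :: "real \<Rightarrow> nat \<Rightarrow> nat \<Rightarrow> real" where
  "box_denom q r m = (\<Prod>i<m. 1 - q powr (real i + (real r + 1) / 2)) *
     (\<Prod>(i, j)\<in>pairs {..<m}. 1 - q powr (real i + real j + real r + 1))"

lemma reflect_lessThan: "(\<lambda>i. m - 1 - i) ` {..<m} = {..<m :: nat}"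
proof (intro equalityI subsetI)
  fix i assume "i \<in> {..<m}"
  thus "i \<in> (\<lambda>i. m - 1 - i) ` {..<m}" by (intro image_eqI[of _ _ "m - 1 - i"]) auto
qed auto

lemma weyl_factor_geometric:
  fixes q :: real
  assumes q: "0 < q" "q < 1"
  shows "weyl_factor ((\<lambda>i. q powr (real m + (real r - 1) / 2 - real i)) ` {..<m}) id = box_denom q r m"
proof -
  define y where "y i = q powr (real i + (real r + 1) / 2)" for i :: nat
  have "(\<lambda>i. q powr (real m + (real r - 1) / 2 - real i)) ` {..<m} = y ` (\<lambda>i. m - 1 - i) ` {..<m}"
    unfolding image_image y_def
    by (rule image_cong) (auto simp: of_nat_diff field_simps)
  also have "(\<lambda>i. m - 1 - i) ` {..<m} = {..<m}" by (rule reflect_lessThan)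
  finally have eq: "(\<lambda>i. q powr (real m + (real r - 1) / 2 - real i)) ` {..<m} = y ` {..<m}" .
  have inj: "inj_on y {..<m}"
    unfolding y_def by (intro inj_powr q) (auto simp: inj_on_def)
  show ?thesis
    unfolding eq weyl_factor_image[OF inj] box_denom_def
    by (auto simp: y_def powr_add[symmetric] add_ac intro!: arg_cong2[of _ _ _ _ "(*)"] prod_pairs_cong
       arg_cong[of _ _ "\<lambda>t. q powr t"])
qed

lemma vdm_geometric_shift:
  fixes q :: real and f g :: "nat \<Rightarrow> real"
  assumes q: "0 < q" "q < 1" and "inj_on f {..<m}" and "\<And>i. i < m \<Longrightarrow> g i = f i + e"
  shows "vdm ((\<lambda>i. q powr g i) ` {..<m}) =
    q powr (e * real m * (real m - 1) / 2) * vdm ((\<lambda>i. q powr f i) ` {..<m})"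
proof -
  have injg: "inj_on g {..<m}"
    using assms(3,4) by (auto simp: inj_on_def)
  have "vdm ((\<lambda>i. q powr g i) ` {..<m}) =
     (\<Prod>(i, j)\<in>pairs {..<m}. (q powr (e / 2) * q powr (e / 2)) * \<bar>q powr f i - q powr f j\<bar>)"
    unfolding vdm_image[OF finite_lessThan inj_powr[OF q injg]]
  proof (rule prod_pairs_cong)
    fix i j assume "i \<in> {..<m}" "j \<in> {..<m}"
    hence "q powr g i - q powr g j = (q powr (e / 2) * q powr (e / 2)) * (q powr f i - q powr f j)"
      using assms(4) by (simp add: powr_add[symmetric] right_diff_distrib)  (simp add: powr_add mult.commute)
    thus "\<bar>q powr g i - q powr g j\<bar> = (q powr (e / 2) * q powr (e / 2)) * \<bar>q powr f i - q powr f j\<bar>"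
      by (simp add: abs_mult)
  qed
  also have "\<dots> = (\<Prod>i<m. q powr (e / 2)) ^ (m - 1) * vdm ((\<lambda>i. q powr f i) ` {..<m})"
    using prod_pairs_mult[OF finite_lessThan, of "\<lambda>_. q powr (e / 2)" m]
    by (simp only: prod_pairs_distrib[of "\<lambda>_ _. q powr (e / 2) * q powr (e / 2)"] card_lessThan
        vdm_image[OF finite_lessThan inj_powr[OF q assms(3)]])
  also have "(\<Prod>i<m. q powr (e / 2)) ^ (m - 1) = q powr (e * real m * (real m - 1) / 2)"
  proof -
    have "(\<Prod>i<m. q powr (e / 2)) ^ (m - 1) = q powr (e / 2 * real (m * (m - 1)))"
      using q by (simp add: powr_power power_mult[symmetric] mult_ac)
    also have "e / 2 * real (m * (m - 1)) = e * real m * (real m - 1) / 2"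
      by (cases m) (simp_all add: field_simps)
    finally show ?thesis .
  qed
  finally show ?thesis .
qed

lemma sum_lessThan_real: "(\<Sum>i<m. real i) = real m * (real m - 1) / 2"
  by (induction m) (auto simp: field_simps)

text \<open>Macdonald's formula is used for both sets of variables, \<open>x\<close> with \<open>n = m + r\<close> and \<open>u\<close> with \<open>n = m\<close>.
  The quotient of the two values of \<open>box_denom\<close> is, in the variable \<open>q powr (1/2)\<close>, the generating
  function of symmetric plane partitions in an \<open>m\<close> by \<open>m\<close> by \<open>r\<close> box.\<close>
theorem geometric_minor_sum:
  fixes q :: real
  assumes q: "0 < q" "q < 1"
  shows "(\<Sum>L\<in>subsets (m + r) m. (\<Prod>l\<in>L. q powr (real l / 2)) * vdm ((\<lambda>l. q ^ l) ` L)) =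
    vdm ((\<lambda>i. q powr (real m - 1/2 - real i)) ` {..<m}) * box_denom q r m / box_denom q 0 m"
proof (cases "m = 0")
  case True
  have "subsets r 0 = {{}}" by (auto simp: subsets_def dest: finite_subset)
  thus ?thesis using True by (simp add: box_denom_def vdm_def)
next
  case False
  define x where "x i = q powr (real m - 1/2 - real i)" for i :: nat
  define p where "p = real (m + r) + real m - 1"
  define u where "u j = q powr (p / 2 - real j)" for j :: nat
  have p2: "p / 2 = real m + (real r - 1) / 2" by (simp add: p_def field_simps)
  have lt1: "q powr e < 1" if "e > 0" for e using q that by (simp add: powr01_less_one)
  have x01: "x ` {..<m} \<subseteq> {0<..<1}" using q by (auto simp: x_def intro!: lt1)
  have "real i < real m + (real r - 1) / 2" if "i < m" for i
  proof -
    have "real i + 1 \<le> real m" using that by simp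
    thus ?thesis by (simp add: field_simps)
  qed
  hence u01: "u ` {..<m} \<subseteq> {0<..<1}" using q by (auto simp: u_def p2 intro!: lt1)
  have mx: "strict_mono_on {..<m} x" and mu: "strict_mono_on {..<m} u"
    using q by (auto intro!: strict_mono_onI simp: x_def u_def powr_less_mono')
  note ix = strict_mono_on_imp_inj_on[OF mx] and iu = strict_mono_on_imp_inj_on[OF mu]
  have dx: "weyl_factor (x ` {..<m}) id = box_denom q 0 m"
    using weyl_factor_geometric[OF q, of m 0] by (simp add: x_def[abs_def])
  have du: "weyl_factor (u ` {..<m}) id = box_denom q r m"
    using weyl_factor_geometric[OF q, of m r] by (simp add: u_def[abs_def] p2)
  define ab where "ab = (\<Prod>i<m. q powr ((real m - 1/2 - real i) * p / 2)) *
    (\<Prod>j<m. q powr (- (p / 2 - real j) * (real m - 1/2)))"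
  have "box_denom q 0 m * minor_sum (m + r) m x = folded_det (m + r) m x"
    using folded_det_eq_minor_sum[OF ix x01] by (simp add: dx)
  also have "\<dots> = ab * folded_det m m u"
    using folded_det_geometric[OF q, of m "m + r"] False
    by (simp add: x_def[abs_def] u_def[abs_def] p_def ab_def)
  also have "folded_det m m u = box_denom q r m * vdm (u ` {..<m})"
    using folded_det_eq_minor_sum[OF iu u01] minor_sum_full[OF iu] vandermonde_mono[OF mu]
    by (simp add: du)
  also have "vdm (u ` {..<m}) = q powr ((p / 2 - real m + 1/2) * real m * (real m - 1) / 2) * vdm (x ` {..<m})"
    unfolding x_def u_def by (intro vdm_geometric_shift q) (auto simp: inj_on_def)
  also have "ab * (box_denom q r m * (q powr ((p / 2 - real m + 1/2) * real m * (real m - 1) / 2) * vdm (x ` {..<m}))) =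
     (ab * q powr ((p / 2 - real m + 1/2) * real m * (real m - 1) / 2)) * (box_denom q r m * vdm (x ` {..<m}))"
    by (simp only: mult_ac)
  \<comment> \<open>The row and column scalings compensate the passage from \<open>vdm\<close> of \<open>u\<close> to \<open>vdm\<close> of \<open>x\<close>.\<close>
  also have "ab * q powr ((p / 2 - real m + 1/2) * real m * (real m - 1) / 2) = 1"
  proof -
    have 1: "(\<Sum>i<m. (real m - 1/2 - real i) * p / 2) = real m ^ 2 * p / 4"
    proof -
      have "(\<Sum>i<m. (real m - 1/2 - real i) * p / 2) = (\<Sum>i<m. real m - 1/2 - real i) * p / 2"
        by (simp only: sum_distrib_right sum_divide_distrib)
      also have "(\<Sum>i<m. real m - 1/2 - real i) = real m ^ 2 / 2"
        unfolding sum_subtractf sum_lessThan_real by (simp add: power2_eq_square field_simps)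
      finally show ?thesis by simp
    qed
    have 2: "(\<Sum>j<m. - (p / 2 - real j) * (real m - 1/2)) =
        - (real m * p / 2 - real m * (real m - 1) / 2) * (real m - 1/2)"
    proof -
      have "(\<Sum>j<m. - (p / 2 - real j) * (real m - 1/2)) =
          (\<Sum>j<m. - (p / 2 - real j)) * (real m - 1/2)"
        by (simp only: sum_distrib_right)
      also have "(\<Sum>j<m. - (p / 2 - real j)) = - (real m * p / 2 - real m * (real m - 1) / 2)"
        unfolding sum_negf sum_subtractf sum_lessThan_real by simp
      finally show ?thesis .
    qed
    have "ab * q powr ((p / 2 - real m + 1/2) * real m * (real m - 1) / 2) =
      q powr (real m ^ 2 * p / 4 + - (real m * p / 2 - real m * (real m - 1) / 2) * (real m - 1/2) +
        (p / 2 - real m + 1/2) * real m * (real m - 1) / 2)"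
      unfolding ab_def using q by (simp only: powr_prod finite_lessThan 1 2 powr_add)
    also have "real m ^ 2 * p / 4 + - (real m * p / 2 - real m * (real m - 1) / 2) * (real m - 1/2) +
        (p / 2 - real m + 1/2) * real m * (real m - 1) / 2 = 0"
      by (simp add: field_simps power2_eq_square)
    finally show ?thesis using q by simp
  qed
  finally have "minor_sum (m + r) m x * box_denom q 0 m = vdm (x ` {..<m}) * box_denom q r m"
    by (simp add: mult_ac)
  moreover have "box_denom q 0 m > 0"
    using weyl_factor_id_nonzero[OF _ x01] by (simp add: dx)
  ultimately show ?thesis
    using minor_sum_geometric[OF q, of "m + r" m] by (simp add: x_def[abs_def] field_simps)
qed

section \<open>Complementary subsets\<close>

text \<open>On both sides each pair inside \<open>K\<close> occurs twice, and each other pair of \<open>A\<close> once.\<close>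
lemma vdm_complement:
  assumes "finite A" "K \<subseteq> A"
  shows "vdm A * vdm K = vdm (A - K) * (\<Prod>a\<in>K. \<Prod>b\<in>A - {a}. \<bar>a - b\<bar>)"
proof -
  have "finite K" using assms finite_subset by blast
  thus ?thesis using assms(2)
  proof (induction K)
    case empty
    thus ?case by (simp add: vdm_def)
  next
    case (insert x K)
    hence "finite (A - K)" "x \<in> A - K" using assms(1) by auto
    hence 1: "vdm (A - K) = vdm (A - insert x K) * (\<Prod>y\<in>A - insert x K. \<bar>x - y\<bar>)"
      using vdm_remove[of "A - K" x] by (simp add: Diff_insert[symmetric])
    have "A - {x} = (A - insert x K) \<union> K" using insert by auto
    hence 2: "(\<Prod>b\<in>A - {x}. \<bar>x - b\<bar>) = (\<Prod>y\<in>A - insert x K. \<bar>x - y\<bar>) * (\<Prod>y\<in>K. \<bar>x - y\<bar>)"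
      using insert assms(1) by (simp only:) (subst prod.union_disjoint, auto)
    show ?case
      using insert 1 by (simp add: vdm_insert 2 mult_ac)
  qed
qed

definition qpoch_nat :: "real \<Rightarrow> nat \<Rightarrow> real" where
  "qpoch_nat q k = (\<Prod>j<k. 1 - q ^ Suc j)"

lemma qpoch_nat_pos:
  assumes "0 < q" "q < 1"
  shows "qpoch_nat q k > 0"
  unfolding qpoch_nat_def using assms by (intro prod_pos) (simp add: power_less_one_iff del: power_Suc)

lemma prod_below_geometric:
  assumes q: "0 < q" "q < 1"
  shows "(\<Prod>b<a. \<bar>q ^ a - q ^ b\<bar>) = q powr (real a * (real a - 1) / 2) * qpoch_nat q a"
proof -
  have "(\<Prod>b<a. \<bar>q ^ a - q ^ b\<bar>) = (\<Prod>b<a. q ^ b * (1 - q ^ (a - b)))"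
  proof (rule prod.cong)
    fix b assume "b \<in> {..<a}"
    hence "q ^ a = q ^ b * q ^ (a - b)" by (simp flip: power_add)
    moreover have "q ^ (a - b) \<le> 1" using q by (simp add: power_le_one)
    ultimately show "\<bar>q ^ a - q ^ b\<bar> = q ^ b * (1 - q ^ (a - b))"
      using q by (simp add: abs_mult right_diff_distrib[symmetric] del: right_diff_distrib)
         (simp add: abs_if right_diff_distrib)
  qed simp
  also have "\<dots> = (\<Prod>b<a. q powr real b) * (\<Prod>b<a. 1 - q ^ (a - b))"
    using q by (simp add: prod.distrib powr_realpow)
  also have "(\<Prod>b<a. q powr real b) = q powr (real a * (real a - 1) / 2)"
    using q by (simp only: powr_prod finite_lessThan sum_lessThan_real)
  also have "(\<Prod>b<a. 1 - q ^ (a - b)) = qpoch_nat q a"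
    unfolding qpoch_nat_def
    by (rule prod.reindex_bij_witness[of _ "\<lambda>j. a - 1 - j" "\<lambda>b. a - 1 - b"])
       (auto simp: Suc_diff_Suc simp del: power_Suc)
  finally show ?thesis .
qed

text \<open>This relates the weights of the sum to distances: up to powers of \<open>q\<close> and a constant, the product of the
  distances from \<open>q\<^sup>a\<close> is the inverse of a \<open>q\<close>-binomial coefficient.\<close>
lemma prod_dist_geometric:
  assumes q: "0 < q" "q < 1" and "a \<le> N"
  shows "(\<Prod>b\<in>{..N} - {a}. \<bar>q ^ a - q ^ b\<bar>) =
    q powr (real a * real N - (real a)\<^sup>2 / 2 - real a / 2) * (qpoch_nat q a * qpoch_nat q (N - a))"
proof -
  have split: "{..N} - {a} = {..<a} \<union> {a<..N}" using assms by auto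
  have "(\<Prod>b\<in>{a<..N}. \<bar>q ^ a - q ^ b\<bar>) = (\<Prod>j<N - a. q ^ a * (1 - q ^ Suc j))"
  proof (rule prod.reindex_bij_witness[of _ "\<lambda>j. a + Suc j" "\<lambda>b. b - a - 1"])
    fix b assume b: "b \<in> {a<..N}"
    hence "q ^ b = q ^ a * q ^ (b - a)" by (simp flip: power_add)
    moreover have "q ^ (b - a) \<le> 1" using q by (simp add: power_le_one)
    moreover have "Suc (b - a - 1) = b - a" using b by auto
    ultimately show "q ^ a * (1 - q ^ Suc (b - a - 1)) = \<bar>q ^ a - q ^ b\<bar>"
      using q by (simp add: right_diff_distrib abs_if del: power_Suc)
  qed auto
  also have "\<dots> = q powr (real a * (real N - real a)) * qpoch_nat q (N - a)"
    using q assms(3) by (simp add: prod.distrib qpoch_nat_def powr_realpow[symmetric] powr_power powr_powr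
        of_nat_diff mult.commute del: power_Suc)
  finally have "(\<Prod>b\<in>{..N} - {a}. \<bar>q ^ a - q ^ b\<bar>) =
     (q powr (real a * (real a - 1) / 2) * q powr (real a * (real N - real a))) *
     (qpoch_nat q a * qpoch_nat q (N - a))"
    unfolding split by (subst prod.union_disjoint) (auto simp: prod_below_geometric[OF q] mult_ac)
  also have "q powr (real a * (real a - 1) / 2) * q powr (real a * (real N - real a)) =
      q powr (real a * (real a - 1) / 2 + real a * (real N - real a))"
    by (simp only: powr_add)
  also have "real a * (real a - 1) / 2 + real a * (real N - real a) =
      real a * real N - (real a)\<^sup>2 / 2 - real a / 2"
    by (simp add: field_simps power2_eq_square)
  finally show ?thesis .
qed

lemma vdm_geometric_split:
  assumes q: "0 < q" "q < 1"
  shows "vdm ((\<lambda>i. q ^ i) ` {..<m + r}) = vdm ((\<lambda>i. q ^ i) ` {..<m}) *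
    (\<Prod>k\<in>{m..<m + r}. q powr (real k * (real k - 1) / 2) * qpoch_nat q k)"
proof (induction r)
  case (Suc r)
  let ?Z = "(\<lambda>i. q ^ i) ` {..<m + r}"
  have ni: "q ^ (m + r) \<notin> ?Z"
    using inj_power[OF q, of UNIV] by (auto simp: inj_on_def)
  have "(\<lambda>i. q ^ i) ` {..<m + Suc r} = insert (q ^ (m + r)) ?Z"
    by (simp add: lessThan_Suc)
  hence "vdm ((\<lambda>i. q ^ i) ` {..<m + Suc r}) = vdm ?Z * (\<Prod>y\<in>?Z. \<bar>q ^ (m + r) - y\<bar>)"
    using ni by (simp add: vdm_insert)
  also have "(\<Prod>y\<in>?Z. \<bar>q ^ (m + r) - y\<bar>) = (\<Prod>b<m + r. \<bar>q ^ (m + r) - q ^ b\<bar>)"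
    using inj_power[OF q] by (simp add: prod.reindex)
  finally show ?case
    by (simp add: prod_below_geometric[OF q] Suc.IH mult_ac)
qed simp

lemma sum_over_injections:
  fixes g :: "'b set \<Rightarrow> real"
  assumes "finite I" "finite A"
    and "\<And>a. a \<in> I \<rightarrow>\<^sub>E A \<Longrightarrow> inj_on a I \<Longrightarrow> f a = g (a ` I)"
    and "\<And>a. a \<in> I \<rightarrow>\<^sub>E A \<Longrightarrow> \<not> inj_on a I \<Longrightarrow> f a = 0"
  shows "(\<Sum>a\<in>I \<rightarrow>\<^sub>E A. f a) = fact (card I) * (\<Sum>K\<in>{K. K \<subseteq> A \<and> card K = card I}. g K)"
proof -
  let ?J = "{a \<in> I \<rightarrow>\<^sub>E A. inj_on a I}"
  let ?S = "{K. K \<subseteq> A \<and> card K = card I}"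
  have finP: "finite (I \<rightarrow>\<^sub>E A)" using assms by (intro finite_PiE) auto
  have finS: "finite ?S" using assms(2) by (auto intro: finite_subset[of _ "Pow A"])
  have finJ: "finite ?J" by (rule finite_subset[OF _ finP]) auto
  have "(\<Sum>a\<in>I \<rightarrow>\<^sub>E A. f a) = (\<Sum>a\<in>?J. g (a ` I))"
    using assms(3,4) finP by (intro sum.mono_neutral_cong_right) auto
  also have "\<dots> = (\<Sum>K\<in>?S. \<Sum>a | a \<in> ?J \<and> a ` I = K. g (a ` I))"
    using finJ finS by (intro sum.group[symmetric]) (auto simp: card_image PiE_def Pi_def)
  also have "\<dots> = (\<Sum>K\<in>?S. fact (card I) * g K)"
  proof (rule sum.cong)
    fix K assume "K \<in> ?S"
    hence K: "K \<subseteq> A" "card K = card I" "finite K" using assms(2) finite_subset by auto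
    have "{a. a \<in> ?J \<and> a ` I = K} = {a \<in> I \<rightarrow>\<^sub>E K. inj_on a I}"
    proof (intro equalityI subsetI)
      fix a assume a: "a \<in> {a \<in> I \<rightarrow>\<^sub>E K. inj_on a I}"
      hence "a ` I \<subseteq> K" "card (a ` I) = card K" using K by (auto simp: card_image)
      hence "a ` I = K" using K(3) by (intro card_subset_eq)
      thus "a \<in> {a. a \<in> ?J \<and> a ` I = K}" using a K by (auto simp: PiE_def Pi_def)
    qed (auto simp: PiE_def Pi_def)
    moreover have "card {a \<in> I \<rightarrow>\<^sub>E K. inj_on a I} = fact (card I)"
      using card_inj_on_subset_funcset[OF assms(1) K(3), of I] K(2)
      by (simp add: fact_prod_rev)
    moreover have "(\<Sum>a | a \<in> ?J \<and> a ` I = K. g (a ` I)) = (\<Sum>a | a \<in> ?J \<and> a ` I = K. g K)"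
      by (rule sum.cong) auto
    ultimately show "(\<Sum>a | a \<in> ?J \<and> a ` I = K. g (a ` I)) = fact (card I) * g K"
      by (simp only: sum_constant) simp
  qed simp
  finally show ?thesis by (simp add: sum_distrib_left)
qed

text \<open>The balance of the powers of \<open>q\<close> in \<open>vandermonde_binomial_sum\<close>: the prefactor, the complementation
  weights and the shift by one half on the left, the quotient of Vandermonde products on the right.\<close>
lemma box_exponents_cancel:
  "(\<Sum>i=1..r. (real m - 1 + real i)\<^sup>2 / 2) - real (m + r) * (real (m + r) - 1) / 4
     + real m * (real m - 1) / 4 = (\<Sum>k\<in>{m..<m + r}. real k * (real k - 1) / 2)"
  by (induction r) (auto simp: field_simps power2_eq_square)

lemma vdm_half_shift:
  assumes q: "0 < q" "q < 1"
  shows "vdm ((\<lambda>i. q powr (real m - 1/2 - real i)) ` {..<m}) =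
    q powr (real m * (real m - 1) / 4) * vdm ((\<lambda>i. q ^ i) ` {..<m})"
proof -
  have "(\<lambda>i. q powr (real m - 1/2 - real i)) ` {..<m} =
      (\<lambda>i. q powr (real i + 1/2)) ` (\<lambda>i. m - 1 - i) ` {..<m}"
    unfolding image_image by (rule image_cong) (auto simp: of_nat_diff algebra_simps)
  also have "\<dots> = (\<lambda>i. q powr (real i + 1/2)) ` {..<m}" by (simp only: reflect_lessThan)
  finally show ?thesis
    using vdm_geometric_shift[OF q, of real m "\<lambda>i. real i + 1/2" "1/2"] q
    by (simp add: powr_realpow inj_on_def mult_ac)
qed

text \<open>The symmetric form of the multiple sum.  Passing to complements reduces it to
  \<open>geometric_minor_sum\<close>.\<close>
theorem vandermonde_binomial_sum:
  assumes q: "0 < q" "q < 1" and N: "Suc N = m + r"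
  shows "(\<Prod>i=1..r. q powr ((real m - 1 + real i)\<^sup>2 / 2)) *
     (\<Sum>a\<in>{1..r} \<rightarrow>\<^sub>E {..N}. (\<Prod>(i, j)\<in>pairs {1..r}. \<bar>q ^ a i - q ^ a j\<bar>) *
        (\<Prod>i=1..r. q powr ((real (a i))\<^sup>2 / 2 - real (a i) * real N) *
            (qpoch_nat q N / (qpoch_nat q (a i) * qpoch_nat q (N - a i))))) =
     fact r * (qpoch_nat q N ^ r / (\<Prod>k\<in>{m..<m + r}. qpoch_nat q k)) *
       (box_denom q r m / box_denom q 0 m)"
proof -
  define z where "z a = q ^ a" for a :: nat
  have injz: "inj_on z S" for S unfolding z_def by (rule inj_power[OF q])
  have A: "{..N} = {..<m + r}" using N by auto
  define w where "w a = q powr ((real a)\<^sup>2 / 2 - real a * real N) *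
            (qpoch_nat q N / (qpoch_nat q a * qpoch_nat q (N - a)))" for a
  define W where "W a = (\<Prod>b\<in>{..N} - {a}. \<bar>z a - z b\<bar>)" for a
  have Wpos: "W a > 0" for a
    unfolding W_def using injz[of UNIV] by (intro prod_pos) (auto simp: inj_on_def)
  have w: "w a = qpoch_nat q N * (q powr (- real a / 2) / W a)" if "a \<le> N" for a
  proof -
    have "W a * q powr ((real a)\<^sup>2 / 2 - real a * real N) =
      q powr (real a * real N - (real a)\<^sup>2 / 2 - real a / 2 + ((real a)\<^sup>2 / 2 - real a * real N)) *
        (qpoch_nat q a * qpoch_nat q (N - a))"
      unfolding W_def z_def prod_dist_geometric[OF q that] powr_add by (simp only: mult_ac)
    hence "W a * q powr ((real a)\<^sup>2 / 2 - real a * real N) =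
      q powr (- real a / 2) * (qpoch_nat q a * qpoch_nat q (N - a))" by simp
    thus ?thesis
      unfolding w_def using Wpos[of a] qpoch_nat_pos[OF q, of a] qpoch_nat_pos[OF q, of "N - a"]
      by (simp add: field_simps)
  qed
  define g where "g K = vdm (z ` K) * (\<Prod>a\<in>K. w a)" for K
  have "(\<Sum>a\<in>{1..r} \<rightarrow>\<^sub>E {..N}. (\<Prod>(i, j)\<in>pairs {1..r}. \<bar>z (a i) - z (a j)\<bar>) * (\<Prod>i=1..r. w (a i))) =
     fact (card {1..r}) * (\<Sum>K\<in>{K. K \<subseteq> {..N} \<and> card K = card {1..r}}. g K)"
  proof (rule sum_over_injections)
    fix a :: "nat \<Rightarrow> nat" assume "inj_on a {1..r}"
    thus "(\<Prod>(i, j)\<in>pairs {1..r}. \<bar>z (a i) - z (a j)\<bar>) * (\<Prod>i=1..r. w (a i)) = g (a ` {1..r})"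
      using vdm_image[of "{1..r}" "\<lambda>i. z (a i)"] comp_inj_on[OF _ injz, of a]
      by (simp add: g_def prod.reindex image_image o_def)
  next
    fix a :: "nat \<Rightarrow> nat" assume "\<not> inj_on a {1..r}"
    then obtain s t where st: "s \<in> {1..r}" "t \<in> {1..r}" "s \<noteq> t" "a s = a t"
      by (auto simp: inj_on_def)
    define i j where "i = min s t" and "j = max s t"
    have ij: "i \<in> {1..r}" "j \<in> {1..r}" "i < j" "a i = a j"
      using st by (auto simp: i_def j_def min_def max_def)
    hence "(i, j) \<in> pairs {1..r}" "\<bar>z (a i) - z (a j)\<bar> = 0" by (auto simp: pairs_def)
    thus "(\<Prod>(i, j)\<in>pairs {1..r}. \<bar>z (a i) - z (a j)\<bar>) * (\<Prod>i=1..r. w (a i)) = 0"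
      by (auto intro!: prod_zero bexI[of _ "(i, j)"])
  qed auto
  also have "{K. K \<subseteq> {..N} \<and> card K = card {1..r}} = subsets (m + r) r"
    by (simp add: subsets_def A)
  also have "(\<Sum>K\<in>subsets (m + r) r. g K) = (\<Sum>K\<in>subsets (m + r) r. qpoch_nat q N ^ r *
      q powr (- (real (m + r) * (real (m + r) - 1) / 4)) / vdm (z ` {..<m + r}) *
      ((\<Prod>l\<in>{..<m + r} - K. q powr (real l / 2)) * vdm (z ` ({..<m + r} - K))))"
  proof (rule sum.cong)
    fix K assume "K \<in> subsets (m + r) r"
    hence K: "K \<subseteq> {..<m + r}" "card K = r" "finite K" by (auto simp: subsets_def intro: finite_subset)
    have "(\<Prod>a\<in>K. w a) = (\<Prod>a\<in>K. qpoch_nat q N * (q powr (- real a / 2) / W a))"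
      using K A by (intro prod.cong w refl) auto
    also have "\<dots> = qpoch_nat q N ^ r * (\<Prod>a\<in>K. q powr (- real a / 2)) / (\<Prod>a\<in>K. W a)"
      by (simp add: prod.distrib prod_dividef K)
    also have "(\<Prod>a\<in>K. q powr (- real a / 2)) =
        q powr (- (real (m + r) * (real (m + r) - 1) / 4)) * (\<Prod>l\<in>{..<m + r} - K. q powr (real l / 2))"
    proof -
      have "(\<Sum>l\<in>{..<m + r}. real l / 2) = (\<Sum>l\<in>{..<m + r} - K. real l / 2) + (\<Sum>l\<in>K. real l / 2)"
        using K(1) by (intro sum.subset_diff) auto
      moreover have "(\<Sum>l\<in>{..<m + r}. real l / 2) = real (m + r) * (real (m + r) - 1) / 4"
        by (simp only: sum_divide_distrib[symmetric] sum_lessThan_real divide_divide_eq_left numeral_times_numeral semiring_norm)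
      moreover have "(\<Sum>a\<in>K. - real a / 2) = - (\<Sum>l\<in>K. real l / 2)" by (simp add: sum_negf)
      ultimately have "(\<Sum>a\<in>K. - real a / 2) =
        - (real (m + r) * (real (m + r) - 1) / 4) + (\<Sum>l\<in>{..<m + r} - K. real l / 2)" by linarith
      thus ?thesis using q K(3) by (simp only: powr_prod finite_Diff finite_lessThan powr_add)
    qed
    finally have pw: "(\<Prod>a\<in>K. w a) = qpoch_nat q N ^ r * (q powr (- (real (m + r) * (real (m + r) - 1) / 4)) *
        (\<Prod>l\<in>{..<m + r} - K. q powr (real l / 2))) / (\<Prod>a\<in>K. W a)" .
    have "(\<Prod>a\<in>z ` K. \<Prod>b\<in>z ` {..<m + r} - {a}. \<bar>a - b\<bar>) = (\<Prod>a\<in>K. W a)"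
    proof -
      have "(\<Prod>b\<in>z ` {..<m + r} - {z a}. \<bar>z a - b\<bar>) = W a" if "a \<in> K" for a
      proof -
        have "z ` {..<m + r} - {z a} = z ` ({..N} - {a})"
          using injz[of UNIV] unfolding A by (auto simp: inj_on_def)
        thus ?thesis unfolding W_def by (simp only: prod.reindex[OF injz] o_def)
      qed
      thus ?thesis by (simp add: prod.reindex[OF injz])
    qed
    hence "vdm (z ` {..<m + r}) * vdm (z ` K) = vdm (z ` ({..<m + r} - K)) * (\<Prod>a\<in>K. W a)"
      using vdm_complement[of "z ` {..<m + r}" "z ` K"] K(1)
      by (simp add: inj_on_image_set_diff[OF injz[of UNIV]] image_mono)
    moreover have "(\<Prod>a\<in>K. W a) > 0" using Wpos by (intro prod_pos) auto
    ultimately show "g K = qpoch_nat q N ^ r *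
      q powr (- (real (m + r) * (real (m + r) - 1) / 4)) / vdm (z ` {..<m + r}) *
      ((\<Prod>l\<in>{..<m + r} - K. q powr (real l / 2)) * vdm (z ` ({..<m + r} - K)))"
      unfolding g_def pw using vdm_pos[of "z ` {..<m + r}"]
      by (simp add: divide_simps) (simp add: mult_ac)
  qed simp
  also have "\<dots> = qpoch_nat q N ^ r *
      q powr (- (real (m + r) * (real (m + r) - 1) / 4)) / vdm (z ` {..<m + r}) *
      (\<Sum>K\<in>subsets (m + r) r. (\<Prod>l\<in>{..<m + r} - K. q powr (real l / 2)) * vdm (z ` ({..<m + r} - K)))"
    by (rule sum_distrib_left[symmetric])
  also have "(\<Sum>K\<in>subsets (m + r) r. (\<Prod>l\<in>{..<m + r} - K. q powr (real l / 2)) * vdm (z ` ({..<m + r} - K))) =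
      (\<Sum>L\<in>subsets (m + r) m. (\<Prod>l\<in>L. q powr (real l / 2)) * vdm (z ` L))"
    by (rule sum.reindex_bij_witness[of _ "\<lambda>L. {..<m + r} - L" "\<lambda>K. {..<m + r} - K"])
       (auto simp: subsets_def double_diff card_Diff_subset finite_subset)
  also have "\<dots> = q powr (real m * (real m - 1) / 4) * vdm (z ` {..<m}) * box_denom q r m / box_denom q 0 m"
    using geometric_minor_sum[OF q, of m r] vdm_half_shift[OF q, of m] by (simp add: z_def[abs_def])
  finally have "(\<Prod>i=1..r. q powr ((real m - 1 + real i)\<^sup>2 / 2)) *
     (\<Sum>a\<in>{1..r} \<rightarrow>\<^sub>E {..N}. (\<Prod>(i, j)\<in>pairs {1..r}. \<bar>z (a i) - z (a j)\<bar>) * (\<Prod>i=1..r. w (a i))) =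
     fact r * (qpoch_nat q N ^ r * vdm (z ` {..<m}) / vdm (z ` {..<m + r})) *
      (q powr (\<Sum>i=1..r. (real m - 1 + real i)\<^sup>2 / 2) *
       q powr (- (real (m + r) * (real (m + r) - 1) / 4)) * q powr (real m * (real m - 1) / 4)) *
       (box_denom q r m / box_denom q 0 m)"
    using q by (simp add: powr_prod)
  also have "q powr (\<Sum>i=1..r. (real m - 1 + real i)\<^sup>2 / 2) *
       q powr (- (real (m + r) * (real (m + r) - 1) / 4)) * q powr (real m * (real m - 1) / 4) =
      q powr (\<Sum>k\<in>{m..<m + r}. real k * (real k - 1) / 2)"
    unfolding powr_add[symmetric] using box_exponents_cancel[where r = r and m = m] by simp
  also have "\<dots> = (\<Prod>k\<in>{m..<m + r}. q powr (real k * (real k - 1) / 2))"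
    using q by (simp only: powr_prod finite_atLeastLessThan)
  also have "fact r * (qpoch_nat q N ^ r * vdm (z ` {..<m}) / vdm (z ` {..<m + r})) *
      (\<Prod>k\<in>{m..<m + r}. q powr (real k * (real k - 1) / 2)) =
      fact r * (qpoch_nat q N ^ r / (\<Prod>k\<in>{m..<m + r}. qpoch_nat q k))"
  proof -
    have "vdm (z ` {..<m + r}) = vdm (z ` {..<m}) * (\<Prod>k\<in>{m..<m + r}. q powr (real k * (real k - 1) / 2)) *
        (\<Prod>k\<in>{m..<m + r}. qpoch_nat q k)"
      using vdm_geometric_split[OF q, of m r] by (simp add: z_def[abs_def] prod.distrib)
    moreover have "(\<Prod>k\<in>{m..<m + r}. q powr (real k * (real k - 1) / 2)) > 0"
      "(\<Prod>k\<in>{m..<m + r}. qpoch_nat q k) > 0"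
      using q qpoch_nat_pos[OF q] by (auto intro!: prod_pos)
    moreover have "F * (X * v / V) * P = F * (X / Q)"
      if "V = v * P * Q" "P > 0" "Q > 0" "v > 0" for F X v V P Q :: real
      using that by simp
    ultimately show ?thesis using vdm_pos[of "z ` {..<m}"] by blast
  qed
  finally show ?thesis unfolding z_def w_def .
qed

section \<open>The product side\<close>

lemma convergent_prod_qpoch:
  fixes a q :: real
  assumes "0 < q" "q < 1"
  shows "convergent_prod (\<lambda>k. 1 - a * q ^ k)"
proof (rule abs_convergent_prod_imp_convergent_prod)
  have "summable (\<lambda>k. \<bar>a\<bar> * q ^ k)"
    using assms by (intro summable_mult summable_geometric) auto
  thus "abs_convergent_prod (\<lambda>k. 1 - a * q ^ k)"
    using assms by (simp add: abs_convergent_prod_conv_summable abs_mult)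
qed

lemma qpoch_inf_step:
  assumes "0 < q" "q < 1" "a \<noteq> 1"
  shows "qpoch_inf a q = (1 - a) * qpoch_inf (a * q) q"
proof -
  have "(\<Prod>k. 1 - a * q ^ Suc k) = qpoch_inf a q / (1 - a * q ^ 0)"
    unfolding qpoch_inf_def
    using assms by (intro prodinf_split_head convergent_prod_qpoch) auto
  thus ?thesis using assms by (simp add: qpoch_inf_def mult.assoc field_simps)
qed

lemma qpoch_inf_nonzero:
  assumes "0 < q" "q < 1" "a < 1"
  shows "qpoch_inf a q \<noteq> 0"
  unfolding qpoch_inf_def
proof (rule prodinf_nonzero)
  show "1 - a * q ^ i \<noteq> 0" for i
  proof -
    have "a * q ^ i < 1"
    proof (cases "a \<le> 0")
      case True
      hence "a * q ^ i \<le> 0" using assms by (simp add: mult_nonpos_nonneg)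
      thus ?thesis by simp
    next
      case False
      hence "a * q ^ i \<le> a * 1" using assms by (intro mult_left_mono power_le_one) auto
      thus ?thesis using assms by simp
    qed
    thus ?thesis by simp
  qed
qed (use assms in \<open>auto intro: convergent_prod_qpoch\<close>)

lemma qpoch_0: "0 < q \<Longrightarrow> q < 1 \<Longrightarrow> a < 1 \<Longrightarrow> qpoch a q 0 = 1"
  by (simp add: qpoch_def qpoch_inf_nonzero)

lemma qpoch_int_step:
  assumes "0 < q" "q < 1" "a < 1" "a * q powi k < 1"
  shows "qpoch a q (k + 1) = qpoch a q k * (1 - a * q powi k)"
proof -
  have eq: "a * q powi (k + 1) = a * q powi k * q"
    using assms by (simp add: power_int_add)
  have "a * q powi k * q < 1"
  proof (cases "a * q powi k \<le> 0")
    case True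
    thus ?thesis using assms by (smt (verit) mult_nonpos_nonneg)
  next
    case False
    thus ?thesis using assms mult_strict_mono[of "a * q powi k" 1 q 1] by simp
  qed
  hence nz: "qpoch_inf (a * q powi k * q) q \<noteq> 0" using assms by (intro qpoch_inf_nonzero)
  have step: "qpoch_inf (a * q powi k) q = (1 - a * q powi k) * qpoch_inf (a * q powi k * q) q"
    using assms by (intro qpoch_inf_step) auto
  have "1 - a * q powi k \<noteq> 0" using assms by simp
  thus ?thesis unfolding qpoch_def eq step using nz by simp
qed

lemma qpoch_of_nat:
  assumes "0 < q" "q < 1" "a < 1"
  shows "qpoch a q (int n) = (\<Prod>k<n. 1 - a * q ^ k)"
proof (induction n)
  case (Suc n)
  have "a * q ^ n < 1"
  proof (cases "a \<le> 0")
    case True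
    hence "a * q ^ n \<le> 0" using assms by (simp add: mult_nonpos_nonneg)
    thus ?thesis by simp
  next
    case False
    hence "a * q ^ n \<le> a * 1" using assms by (intro mult_left_mono power_le_one) auto
    thus ?thesis using assms by simp
  qed
  thus ?case
    using qpoch_int_step[of q a "int n"] assms Suc.IH by (simp add: add.commute)
qed (use assms qpoch_0 in simp)

lemma qpoch_self_of_nat:
  assumes "0 < q" "q < 1"
  shows "qpoch q q (int n) = qpoch_nat q n"
  using qpoch_of_nat[OF assms assms(2)] by (simp add: qpoch_nat_def)

text \<open>Shift by one, allowing the index -1.\<close>

text \<open>The case \<open>m = 0\<close> is where the index -1 occurs: there the product with base \<open>b q\<close> is \<open>1 / (1 + b)\<close>.  The
  extreme case \<open>2n = r - 1\<close> of the theorem depends on it.\<close>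
lemma qpoch_neg_minus_one:
  assumes "0 < q" "q < 1" "b > 0"
  shows "qpoch (- (b * q)) q (int m - 1) = (\<Prod>k<m. 1 + b * q ^ k) / (1 + b)"
proof (induction m)
  case 0
  have one: "1 - - (b * q) * q powi (- 1) = 1 + b"
    using assms by (simp add: power_int_minus)
  have "qpoch (- (b * q)) q ((- 1) + 1) = qpoch (- (b * q)) q (- 1) * (1 - - (b * q) * q powi (- 1))"
    using assms by (intro qpoch_int_step) (auto simp: power_int_minus intro: order.strict_trans[of _ 0])
  moreover have "qpoch (- (b * q)) q 0 = 1"
    using assms by (intro qpoch_0) (auto intro: order.strict_trans[of _ 0])
  ultimately have "qpoch (- (b * q)) q (- 1) * (1 + b) = 1" unfolding one by simp
  thus ?case using assms by (simp add: field_simps)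
next
  case (Suc m)
  have eq: "- (b * q) * q powi (int m - 1) = - (b * q ^ m)"
    using assms by (simp add: power_int_diff)
  have neg: "- (b * q) < 1" "- (b * q ^ m) < 1"
    using assms by (auto intro: order.strict_trans[of _ 0])
  have "qpoch (- (b * q)) q (int m - 1 + 1) =
      qpoch (- (b * q)) q (int m - 1) * (1 - (- (b * q) * q powi (int m - 1)))"
    using assms(1,2) neg(1) neg(2)[folded eq] by (rule qpoch_int_step)
  hence "qpoch (- (b * q)) q (int m) = qpoch (- (b * q)) q (int m - 1) * (1 + b * q ^ m)"
    unfolding eq by simp
  thus ?case using Suc.IH by simp
qed

lemma qGamma_nonzero:
  assumes "0 < q" "q < 1" "x > 0"
  shows "qGamma q x \<noteq> 0"
  using assms qpoch_inf_nonzero[of q q] qpoch_inf_nonzero[of q "q powr x"]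
  by (simp add: qGamma_def powr01_less_one)

lemma qGamma_step:
  assumes "0 < q" "q < 1" "x > 0"
  shows "qGamma q (x + 1) = (1 - q powr x) / (1 - q) * qGamma q x"
proof -
  have lt: "q powr x < 1" using assms by (simp add: powr01_less_one)
  hence step: "qpoch_inf (q powr x) q = (1 - q powr x) * qpoch_inf (q powr (x + 1)) q"
    using qpoch_inf_step[of q "q powr x"] assms by (simp add: powr_add)
  have pw: "(1 - q) powr (1 - x) = (1 - q) powr (1 - (x + 1)) * (1 - q)"
    using assms powr_add[of "1 - q" "- x" 1] by simp
  have "1 - q powr x \<noteq> 0" "1 - q \<noteq> 0" using assms lt by auto
  thus ?thesis unfolding qGamma_def step pw by simp
qed

lemma qGamma_add_nat:
  assumes "0 < q" "q < 1" "x > 0"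
  shows "qGamma q (x + real n) = (\<Prod>k<n. (1 - q powr (x + real k)) / (1 - q)) * qGamma q x"
proof (induction n)
  case (Suc n)
  have "qGamma q (x + real n + 1) = (1 - q powr (x + real n)) / (1 - q) * qGamma q (x + real n)"
    using assms by (intro qGamma_step) auto
  thus ?case using Suc.IH by (simp add: add_ac)
qed simp

lemma qGamma_1: "0 < q \<Longrightarrow> q < 1 \<Longrightarrow> qGamma q 1 = 1"
  using qpoch_inf_nonzero[of q q] by (simp add: qGamma_def)

lemma qGamma_of_nat:
  assumes "0 < q" "q < 1"
  shows "qGamma q (real n + 1) = qpoch_nat q n / (1 - q) ^ n"
  using qGamma_add_nat[OF assms, of 1 n] assms
  by (simp add: qGamma_1 qpoch_nat_def prod_dividef add.commute powr_add powr_realpow)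

text \<open>The right-hand side of the theorem without \<open>r!\<close> and without the factors
  \<open>\<Gamma>\<^sub>q(2n + 1) / \<Gamma>\<^sub>q(2n - i + 2)\<close>, with \<open>2n = m + r - 1\<close>; the factors
  \<open>\<Gamma>\<^sub>q(2n - i + 5/2)\<close> are taken in reverse order, so that they do not depend on \<open>r\<close>.\<close>
definition gamma_product :: "real \<Rightarrow> nat \<Rightarrow> nat \<Rightarrow> real" where
  "gamma_product q m r = (\<Prod>i=1..r. qpoch (- (q powr (1/2))) (q powr (1/2)) (int i) *
       qpoch (- (q powr (real i / 2 + 1))) q (int m - 1) *
       (qGamma q (1 + real i / 2) / qGamma q (3/2)) *
       (qGamma q (real m + real i + 1/2) / qGamma q (real m + real r + 1 - real i / 2)))
     / qfact (q powr (1/2)) r"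

text \<open>A form of Legendre's duplication formula for \<open>\<Gamma>\<^sub>q\<close>, at half-integers, where it follows from the
  functional equation.\<close>
lemma half_step_gamma:
  assumes q: "0 < q" "q < 1"
  shows "qpoch (- (q powr (1/2))) (q powr (1/2)) (int r) *
      qGamma q (real r / 2 + 3/2) * qGamma q (real r / 2 + 1) =
      qGamma q (3/2) * qGamma q (real r + 1) * qbracket (q powr (1/2)) (real r + 1)"
proof (induction r)
  case 0
  define s where "s = q powr (1/2)"
  have s: "0 < s" "s < 1" using q by (auto simp: s_def powr01_less_one)
  show ?case using s q by (simp add: qpoch_0 qGamma_1 qbracket_def flip: s_def)
next
  case (Suc r)
  define s where "s = q powr (1/2)"
  have s: "0 < s" "s < 1" using q by (auto simp: s_def powr01_less_one)
  have sq: "q powr (real k / 2) = s ^ k" for k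
    using q by (simp add: s_def powr_power)
  have br: "qbracket s (real r + 1) = (1 - s ^ Suc r) / (1 - s)" for r
    using s powr_realpow[of s "Suc r"] by (simp add: qbracket_def add.commute)
  have alg: "p' * g1' * g2' = c * G' * b'"
    if "p' = p * (1 + t)" "g1' = u / Q * g2" "g2' = g1" "G' = e / Q * G" "e = (1 - t) * (1 + t)"
      "p * g1 * g2 = c * G * ((1 - t) / d)" "b' = u / d"
    for p p' g1 g1' g2 g2' c G G' b' t u Q e d :: real
  proof -
    have "p' * g1' * g2' = (p * g1 * g2) * (1 + t) * u / Q" using that(1-3) by simp
    also have "\<dots> = c * G' * b'" unfolding that(4-7) by (simp add: mult_ac)
    finally show ?thesis .
  qed
  show ?case unfolding s_def[symmetric]
  proof (rule alg)
    show "qpoch (- s) s (int (Suc r)) = qpoch (- s) s (int r) * (1 + s ^ Suc r)"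
      using s by (subst (1 2) qpoch_of_nat) auto
    have "real (Suc (Suc r)) / 2 = real r / 2 + 1" by simp
    hence "q powr (real r / 2 + 1) = s ^ Suc (Suc r)" using sq[of "Suc (Suc r)"] by metis
    moreover have "real (Suc r) / 2 + 3/2 = real r / 2 + 1 + 1" by (simp add: field_simps)
    ultimately show "qGamma q (real (Suc r) / 2 + 3/2) =
        (1 - s ^ Suc (Suc r)) / (1 - q) * qGamma q (real r / 2 + 1)"
      using qGamma_step[OF q, of "real r / 2 + 1"] by simp
    show "qGamma q (real (Suc r) / 2 + 1) = qGamma q (real r / 2 + 3/2)"
      by (rule arg_cong[of _ _ "qGamma q"]) (simp add: field_simps)
    show "qGamma q (real (Suc r) + 1) = (1 - q powr (real r + 1)) / (1 - q) * qGamma q (real r + 1)"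
      using qGamma_step[OF q, of "real r + 1"] by (simp add: add.commute)
    have "real r + 1 = real (Suc r + Suc r) / 2" by (simp add: field_simps)
    hence "q powr (real r + 1) = q powr (real (Suc r + Suc r) / 2)" by (simp only:)
    also have "\<dots> = s ^ Suc r * s ^ Suc r" by (simp only: sq power_add)
    finally show "1 - q powr (real r + 1) = (1 - s ^ Suc r) * (1 + s ^ Suc r)"
      by (simp add: algebra_simps)
    show "qpoch (- s) s (int r) * qGamma q (real r / 2 + 3/2) * qGamma q (real r / 2 + 1) =
        qGamma q (3/2) * qGamma q (real r + 1) * ((1 - s ^ Suc r) / (1 - s))"
      using Suc.IH unfolding s_def[symmetric] br .
    show "qbracket s (real (Suc r) + 1) = (1 - s ^ Suc (Suc r)) / (1 - s)"
      by (rule br)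
  qed
qed


text \<open>The factor of a pair \<open>(i, j)\<close> depends on \<open>i + j\<close> only, so for a fixed larger element the quotient
  telescopes to its two ends.\<close>
lemma box_denom_pairs_shift:
  "(\<Prod>(i, j)\<in>pairs {..<m}. 1 - q powr (real i + real j + c + 1)) * (\<Prod>k<m. 1 - q powr (real k + c)) =
   (\<Prod>(i, j)\<in>pairs {..<m}. 1 - q powr (real i + real j + c)) * (\<Prod>k<m. 1 - q powr (2 * real k + c))"
proof (induction m)
  case (Suc m)
  have split: "(\<Prod>(i, j)\<in>pairs {..<Suc m}. 1 - q powr (real i + real j + d)) =
     (\<Prod>(i, j)\<in>pairs {..<m}. 1 - q powr (real i + real j + d)) * (\<Prod>j<m. 1 - q powr (real m + real j + d))" for d
    unfolding lessThan_Suc by (rule prod_pairs_insert) (auto simp: add.commute)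
  have "(\<Prod>j<m. 1 - q powr (real m + real j + (c + 1))) * (1 - q powr (real m + c)) =
      (\<Prod>j<Suc m. 1 - q powr (real m + real j + c))"
    by (subst prod.lessThan_Suc_shift) (simp add: add_ac)
  also have "\<dots> = (\<Prod>j<m. 1 - q powr (real m + real j + c)) * (1 - q powr (2 * real m + c))"
    by simp
  finally have tel: "(\<Prod>j<m. 1 - q powr (real m + real j + (c + 1))) * (1 - q powr (real m + c)) =
    (\<Prod>j<m. 1 - q powr (real m + real j + c)) * (1 - q powr (2 * real m + c))" .
  have alg: "(a * b) * (d * e) = (a' * b') * (d' * e')"
    if "a * d = a' * d'" "b * e = b' * e'" for a b d e a' b' d' e' :: real
  proof -
    have "(a * b) * (d * e) = (a * d) * (b * e)" by (simp only: mult_ac)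
    also have "\<dots> = (a' * b') * (d' * e')" unfolding that by (simp only: mult_ac)
    finally show ?thesis .
  qed
  show ?case
    unfolding prod.lessThan_Suc add.assoc[of _ c 1] split
    by (rule alg[OF Suc.IH[unfolded add.assoc[of _ c 1]] tel])
qed simp

lemma box_denom_Suc:
  assumes q: "0 < q" "q < 1"
  shows "box_denom q (Suc r) m * (\<Prod>k<m. 1 - q powr (real r + 1 + real k)) =
    box_denom q r m * (\<Prod>k<m. 1 - q powr (real r / 2 + 1 + real k)) *
      (\<Prod>k<m. 1 + q powr ((real r + 1) / 2) * q ^ k)"
proof -
  have sq: "1 - q powr (2 * real k + (real r + 1)) =
      (1 - q powr (real k + (real r + 1) / 2)) * (1 + q powr ((real r + 1) / 2) * q ^ k)" for k
  proof -
    have "q powr (2 * real k + (real r + 1)) =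
        q powr ((real k + (real r + 1) / 2) + (real k + (real r + 1) / 2))"
      by (simp add: algebra_simps)
    also have "\<dots> = q powr (real k + (real r + 1) / 2) * q powr (real k + (real r + 1) / 2)"
      by (rule powr_add)
    finally show ?thesis using q by (simp add: powr_add powr_realpow algebra_simps)
  qed
  define P where "P r = (\<Prod>(i, j)\<in>pairs {..<m}. 1 - q powr (real i + real j + (real r + 1)))" for r :: nat
  define Q where "Q r = (\<Prod>k<m. 1 - q powr (real k + (real r + 1) / 2))" for r :: nat
  define R where "R = (\<Prod>k<m. 1 - q powr (real r + 1 + real k))"
  define T where "T = (\<Prod>k<m. 1 + q powr ((real r + 1) / 2) * q ^ k)"
  have box: "box_denom q r m = Q r * P r" for r
    by (simp add: box_denom_def P_def Q_def add.assoc)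
  have "P (Suc r) * R = P r * (\<Prod>k<m. 1 - q powr (2 * real k + (real r + 1)))"
    using box_denom_pairs_shift[where m = m and q = q and c = "real r + 1"] by (simp add: P_def R_def add_ac)
  also have "(\<Prod>k<m. 1 - q powr (2 * real k + (real r + 1))) = Q r * T"
    unfolding sq prod.distrib Q_def T_def ..
  finally have PR: "P (Suc r) * R = P r * (Q r * T)" .
  have QS: "Q (Suc r) = (\<Prod>k<m. 1 - q powr (real r / 2 + 1 + real k))"
    unfolding Q_def by (rule prod.cong) (auto simp: field_simps intro!: arg_cong[of _ _ "\<lambda>t. q powr t"])
  have "box_denom q (Suc r) m * R = Q (Suc r) * (P (Suc r) * R)" by (simp only: box mult_ac)
  also have "\<dots> = box_denom q r m * Q (Suc r) * T" unfolding PR box by (simp only: mult_ac)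
  finally show ?thesis unfolding QS R_def T_def .
qed

lemma box_denom_pos:
  assumes q: "0 < q" "q < 1"
  shows "box_denom q r m > 0"
  unfolding box_denom_def using q
  by (auto intro!: mult_pos_pos prod_pos simp: powr01_less_one add_pos_nonneg add_nonneg_pos)

text \<open>The arguments form an arithmetic progression with step 1/2, and increasing \<open>r\<close> by one adds two
  terms at its upper end and removes the lowest one.\<close>
lemma gamma_denominator_shift:
  fixes G :: "real \<Rightarrow> real"
  shows "(\<Prod>i=1..Suc r. G (c + real (Suc r) + 1 - real i / 2)) * G (c + real r / 2 + 1) =
    G (c + real r + 3/2) * G (c + real r + 1) * (\<Prod>i=1..r. G (c + real r + 1 - real i / 2))"
proof -
  define H where "H i = G (c + real r + 2 - real i / 2)" for i :: nat
  have "(\<Prod>i=1..Suc r. G (c + real (Suc r) + 1 - real i / 2)) * G (c + real r / 2 + 1) =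
      (\<Prod>i=1..Suc r. H i) * H (Suc (Suc r))"
  proof -
    have "G (c + real (Suc r) + 1 - real i / 2) = H i" for i
      unfolding H_def by (rule arg_cong[of _ _ G]) simp
    moreover have "G (c + real r / 2 + 1) = H (Suc (Suc r))"
      unfolding H_def by (rule arg_cong[of _ _ G]) (simp add: field_simps)
    ultimately show ?thesis by (simp only:)
  qed
  also have "\<dots> = H 1 * (H 2 * (\<Prod>i=1..r. H (Suc (Suc i))))"
    by (induction r) (simp_all add: numeral_2_eq_2 mult_ac)
  also have "H 1 = G (c + real r + 3/2)" unfolding H_def by (rule arg_cong[of _ _ G]) simp
  also have "H 2 = G (c + real r + 1)" unfolding H_def by (rule arg_cong[of _ _ G]) simp
  also have "(\<Prod>i=1..r. H (Suc (Suc i))) = (\<Prod>i=1..r. G (c + real r + 1 - real i / 2))"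
    unfolding H_def by (intro prod.cong refl arg_cong[of _ _ G]) (simp add: field_simps)
  finally show ?thesis by (simp only: mult.assoc)
qed

text \<open>Both sides are multiplied by the same factor when \<open>r\<close> grows by one.  On the left this factor
  contains \<open>\<Gamma>\<^sub>q\<close> at \<open>r/2 + 1\<close> and \<open>r/2 + 3/2\<close>, which the duplication formula removes.\<close>
theorem gamma_product_eq_box:
  assumes q: "0 < q" "q < 1"
  shows "gamma_product q m r = box_denom q r m / box_denom q 0 m"
proof (induction r)
  case 0
  show ?case using box_denom_pos[OF q, of 0 m] by (simp add: gamma_product_def qfact_def)
next
  case (Suc r)
  define s where "s = q powr (1/2)"
  have s: "0 < s" "s < 1" using q by (auto simp: s_def powr01_less_one)
  define b where "b = q powr ((real r + 1) / 2)"
  have b: "b > 0" "s ^ Suc r = b" using q by (simp_all add: b_def s_def powr_power add.commute del: power_Suc)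
  let ?G = "qGamma q"
  define A B C where "A i = qpoch (- s) s (int i)"
    and "B i = qpoch (- (q powr (real i / 2 + 1))) q (int m - 1)"
    and "C i = ?G (1 + real i / 2) / ?G (3/2)" for i
  define D where "D r = (\<Prod>i=1..r. ?G (real m + real r + 1 - real i / 2))" for r :: nat
  define E where "E r = (\<Prod>i=1..r. A i * B i * C i * ?G (real m + real i + 1/2))" for r :: nat
  have gp: "gamma_product q m r = E r / D r / qfact s r" for r
  proof -
    have "gamma_product q m r = (\<Prod>i=1..r. A i * B i * C i * ?G (real m + real i + 1/2) /
        ?G (real m + real r + 1 - real i / 2)) / qfact s r"
      by (simp add: gamma_product_def A_def B_def C_def s_def)
    thus ?thesis by (simp only: prod_dividef E_def D_def)
  qed
  define g1 g2 g3 where "g1 = ?G (real r / 2 + 3/2)" and "g2 = ?G (real r / 2 + 1)" and "g3 = ?G (real r + 1)"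
  define c where "c = ?G (3/2)"
  define u v where "u = ?G (real m + real r / 2 + 1)" and "v = ?G (real m + real r + 1)"
  define w where "w = ?G (real m + real r + 3/2)"
  define U V T where "U = (\<Prod>k<m. 1 - q powr (real r / 2 + 1 + real k))"
    and "V = (\<Prod>k<m. 1 - q powr (real r + 1 + real k))" and "T = (\<Prod>k<m. 1 + b * q ^ k)"
  define h where "h = qbracket s (real r + 1)"
  have E: "E (Suc r) = E r * (A r * (1 + b) * (T / (1 + b)) * (g1 / c) * w)"
  proof -
    have "A (Suc r) = A r * (1 + b)"
      unfolding A_def b(2)[symmetric] using s by (subst (1 2) qpoch_of_nat) auto
    moreover have "q powr (real (Suc r) / 2 + 1) = b * q"
      using q by (simp add: b_def powr_add add.commute)
    hence "B (Suc r) = T / (1 + b)"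
      using qpoch_neg_minus_one[OF q b(1), of m] by (simp add: B_def T_def)
    moreover have "C (Suc r) = g1 / c"
      by (simp add: C_def g1_def c_def add_divide_distrib add_ac)
    moreover have "?G (real m + real (Suc r) + 1/2) = w"
      unfolding w_def by (rule arg_cong[of _ _ ?G]) simp
    ultimately show ?thesis by (simp add: E_def)
  qed
  have D: "D (Suc r) * u = w * v * D r"
    using gamma_denominator_shift[of ?G "real m" r] by (simp only: D_def u_def v_def w_def)
  have F: "qfact s (Suc r) = qfact s r * h"
    by (simp add: qfact_def h_def add.commute)
  have half: "A r * g1 * g2 = c * g3 * h"
    using half_step_gamma[OF q, of r] by (simp add: A_def g1_def g2_def c_def g3_def h_def s_def)
  have u: "u = U / (1 - q) ^ m * g2"
    using qGamma_add_nat[OF q, of "real r / 2 + 1" m]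
    by (simp add: u_def U_def g2_def prod_dividef add_ac)
  have v: "v = V / (1 - q) ^ m * g3"
    using qGamma_add_nat[OF q, of "real r + 1" m]
    by (simp add: v_def V_def g3_def prod_dividef add_ac)
  have nz: "u \<noteq> 0" "v \<noteq> 0" "w \<noteq> 0" "c \<noteq> 0" "g3 \<noteq> 0"
    unfolding u_def v_def w_def c_def g3_def using q by (auto intro!: qGamma_nonzero[OF q])
  have "h \<noteq> 0" using s by (simp add: h_def qbracket_def powr01_less_one less_imp_neq)
  have Dnz: "D r \<noteq> 0" for r
    unfolding D_def using q by (auto intro!: qGamma_nonzero[OF q] simp: field_simps)
  have box: "box_denom q (Suc r) m * V = box_denom q r m * U * T"
    using box_denom_Suc[OF q, of r m] by (simp only: U_def V_def T_def b_def)
  have Vnz: "V \<noteq> 0" using v nz by auto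
  have "1 + b \<noteq> 0" using b by simp
  have "gamma_product q m (Suc r) = gamma_product q m r * (A r * T * g1 * u / (c * v * h))"
  proof -
    have "D (Suc r) = w * v * D r / u" using D nz by (simp add: field_simps)
    thus ?thesis unfolding gp E F using nz \<open>1 + b \<noteq> 0\<close> by (simp add: mult_ac)
  qed
  also have "A r * T * g1 * u / (c * v * h) = (A r * g1 * g2) * T * U / (c * g3 * h * V)"
    unfolding u v using q by (simp add: mult_ac)
  also have "\<dots> = T * U / V" unfolding half using nz \<open>h \<noteq> 0\<close> by simp
  also have "gamma_product q m r * (T * U / V) = box_denom q (Suc r) m / box_denom q 0 m"
  proof -
    have "box_denom q (Suc r) m = box_denom q r m * (T * U / V)"
      using box Vnz by (simp add: divide_simps)
    thus ?thesis by (simp add: Suc.IH)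
  qed
  finally show ?case .
qed

section \<open>The multiple sum\<close>

lemma prod_pairs_fst:
  fixes f :: "nat \<Rightarrow> 'a::comm_monoid_mult"
  shows "(\<Prod>(i, j)\<in>pairs {1..r}. f i) = (\<Prod>i=1..r. f i ^ (r - i))"
proof -
  have "pairs {1..r} = Sigma {1..r} (\<lambda>i. {i<..r})" by (auto simp: pairs_def)
  hence "(\<Prod>(i, j)\<in>pairs {1..r}. f i) = (\<Prod>i=1..r. \<Prod>j\<in>{i<..r}. f i)"
    by (simp only:) (subst prod.Sigma, auto)
  thus ?thesis by simp
qed

lemma abs_qbracket_diff:
  assumes q: "0 < q" "q < 1"
  shows "\<bar>qbracket q (real b - real a)\<bar> = 1 / (1 - q) * q powr (- real a) * \<bar>q ^ a - q ^ b\<bar>"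
proof -
  have "q powr (real b - real a) = q powr (- real a) * q ^ b"
    using q by (simp add: powr_diff powr_minus powr_realpow field_simps)
  moreover have "1 = q powr (- real a) * q ^ a"
    using q by (simp add: powr_minus powr_realpow)
  ultimately have "1 - q powr (real b - real a) = q powr (- real a) * (q ^ a - q ^ b)"
    by (simp add: right_diff_distrib)
  thus ?thesis using q by (simp add: qbracket_def abs_mult)
qed

lemma qbinom_of_nat:
  assumes q: "0 < q" "q < 1" and "a \<le> N"
  shows "qbinom q (int N) (int N - int a) = qpoch_nat q N / (qpoch_nat q a * qpoch_nat q (N - a))"
proof -
  have "int N - int a = int (N - a)" "int N - (int N - int a) = int a" using assms(3) by auto
  thus ?thesis unfolding qbinom_def by (simp only: qpoch_self_of_nat[OF q] mult.commute)
qed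

text \<open>The bracket \<open>\<bar>[k\<^sub>i - k\<^sub>j]\<bar>\<close> with \<open>i < j\<close> contributes \<open>q powr (- a\<^sub>i)\<close>, so \<open>a\<^sub>i\<close> receives the weight
  \<open>r - i\<close>.  This removes the dependence on \<open>i\<close> from the coefficient of \<open>a\<^sub>i\<close> in the exponent.\<close>
lemma summand_conversion:
  assumes q: "0 < q" "q < 1" and N: "Suc N = m + r" and a: "a \<in> {1..r} \<rightarrow>\<^sub>E {..N}"
  shows "(\<Prod>(i, j)\<in>pairs {1..r}. \<bar>qbracket q (real (a j) - real (a i))\<bar>) *
      (\<Prod>i=1..r. q powr ((real N - real (a i) - real r + real i)\<^sup>2 / 2) *
         qbinom q (int N) (int N - int (a i))) =
    (\<Prod>i=1..r. (1 / (1 - q)) ^ (r - i)) * ((\<Prod>i=1..r. q powr ((real m - 1 + real i)\<^sup>2 / 2)) *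
      ((\<Prod>(i, j)\<in>pairs {1..r}. \<bar>q ^ a i - q ^ a j\<bar>) *
        (\<Prod>i=1..r. q powr ((real (a i))\<^sup>2 / 2 - real (a i) * real N) *
            (qpoch_nat q N / (qpoch_nat q (a i) * qpoch_nat q (N - a i))))))"
proof -
  have aN: "a i \<le> N" if "i \<in> {1..r}" for i using a that by (auto simp: PiE_def Pi_def)
  have m: "real m = real N + 1 - real r" using arg_cong[OF N, of real] by simp
  have "(\<Prod>(i, j)\<in>pairs {1..r}. \<bar>qbracket q (real (a j) - real (a i))\<bar>) =
     (\<Prod>(i, j)\<in>pairs {1..r}. (1 / (1 - q) * q powr (- real (a i))) * \<bar>q ^ a i - q ^ a j\<bar>)"
    by (rule prod_pairs_cong) (simp only: abs_qbracket_diff[OF q])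
  also have "\<dots> = (\<Prod>i=1..r. (1 / (1 - q)) ^ (r - i)) * (\<Prod>i=1..r. (q powr (- real (a i))) ^ (r - i)) *
      (\<Prod>(i, j)\<in>pairs {1..r}. \<bar>q ^ a i - q ^ a j\<bar>)"
    by (simp only: prod_pairs_distrib[of "\<lambda>i j. 1 / (1 - q) * q powr (- real (a i))"] prod_pairs_fst
        power_mult_distrib prod.distrib)
  finally have 1: "(\<Prod>(i, j)\<in>pairs {1..r}. \<bar>qbracket q (real (a j) - real (a i))\<bar>) = \<dots>" .
  have 2: "(q powr (- real (a i))) ^ (r - i) *
      (q powr ((real N - real (a i) - real r + real i)\<^sup>2 / 2) * qbinom q (int N) (int N - int (a i))) =
      q powr ((real m - 1 + real i)\<^sup>2 / 2) * (q powr ((real (a i))\<^sup>2 / 2 - real (a i) * real N) *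
            (qpoch_nat q N / (qpoch_nat q (a i) * qpoch_nat q (N - a i))))"
    if i: "i \<in> {1..r}" for i
  proof -
    have "(q powr (- real (a i))) ^ (r - i) = q powr (- real (a i) * (real r - real i))"
      using q i by (simp add: powr_power of_nat_diff mult.commute)
    hence "(q powr (- real (a i))) ^ (r - i) * q powr ((real N - real (a i) - real r + real i)\<^sup>2 / 2) =
      q powr (- real (a i) * (real r - real i) + (real N - real (a i) - real r + real i)\<^sup>2 / 2)"
      by (simp only: powr_add)
    also have "- real (a i) * (real r - real i) + (real N - real (a i) - real r + real i)\<^sup>2 / 2 =
      (real m - 1 + real i)\<^sup>2 / 2 + ((real (a i))\<^sup>2 / 2 - real (a i) * real N)"
      unfolding m by (simp add: power2_eq_square field_simps)
    finally show ?thesis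
      unfolding qbinom_of_nat[OF q aN[OF i]] mult.assoc[symmetric] by (simp only: powr_add)
  qed
  have "(\<Prod>i=1..r. (q powr (- real (a i))) ^ (r - i)) *
      (\<Prod>i=1..r. q powr ((real N - real (a i) - real r + real i)\<^sup>2 / 2) *
         qbinom q (int N) (int N - int (a i))) =
     (\<Prod>i=1..r. q powr ((real m - 1 + real i)\<^sup>2 / 2)) *
     (\<Prod>i=1..r. q powr ((real (a i))\<^sup>2 / 2 - real (a i) * real N) *
            (qpoch_nat q N / (qpoch_nat q (a i) * qpoch_nat q (N - a i))))"
    unfolding prod.distrib[symmetric] by (rule prod.cong[OF refl 2])
  moreover have "(k * b * v) * d = k * (e * (v * f))" if "b * d = e * f" for k b v d e f :: real
  proof -
    have "(k * b * v) * d = k * (b * d) * v" by (simp only: mult_ac)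
    thus ?thesis unfolding that by (simp only: mult_ac)
  qed
  ultimately show ?thesis unfolding 1 by blast
qed

lemma sum_over_steps:
  assumes "2 * n = real N"
  shows "(\<Sum>k\<in>I \<rightarrow>\<^sub>E steps n. F k) = (\<Sum>a\<in>I \<rightarrow>\<^sub>E {..N}. F (\<lambda>i\<in>I. n - real (a i)))"
proof (rule sum.reindex_bij_witness[of _ "\<lambda>a. \<lambda>i\<in>I. n - real (a i)" "\<lambda>k. \<lambda>i\<in>I. nat \<lfloor>n - k i\<rfloor>"])
  have steps: "\<exists>a\<le>N. n - x = real a" if "x \<in> steps n" for x
  proof -
    have "n + x \<in> \<int>" using that by (simp add: steps_def)
    then obtain z where z: "n + x = of_int z" by (elim Ints_cases)
    have "n - x = of_int (int N - z)" using z assms by simp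
    moreover have "0 \<le> n - x" "n - x \<le> real N" using that assms by (auto simp: steps_def)
    ultimately have "0 \<le> int N - z" "int N - z \<le> int N" by linarith+
    thus ?thesis using \<open>n - x = of_int (int N - z)\<close> by (intro exI[of _ "nat (int N - z)"]) auto
  qed
  fix k assume k: "k \<in> I \<rightarrow>\<^sub>E steps n"
  have val: "n - real (nat \<lfloor>n - k i\<rfloor>) = k i" "nat \<lfloor>n - k i\<rfloor> \<le> N" if i: "i \<in> I" for i
  proof -
    have "k i \<in> steps n" using k i by auto
    then obtain a where "a \<le> N" "n - k i = real a" using steps by blast
    thus "n - real (nat \<lfloor>n - k i\<rfloor>) = k i" "nat \<lfloor>n - k i\<rfloor> \<le> N" by auto
  qed
  show eq: "(\<lambda>i\<in>I. n - real ((\<lambda>i\<in>I. nat \<lfloor>n - k i\<rfloor>) i)) = k"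
    using k val(1) by (intro PiE_ext[OF _ k]) (auto simp: PiE_def Pi_def)
  show "(\<lambda>i\<in>I. nat \<lfloor>n - k i\<rfloor>) \<in> I \<rightarrow>\<^sub>E {..N}" using val(2) by auto
  show "F (\<lambda>i\<in>I. n - real ((\<lambda>i\<in>I. nat \<lfloor>n - k i\<rfloor>) i)) = F k" by (simp only: eq)
next
  fix a assume a: "a \<in> I \<rightarrow>\<^sub>E {..N}"
  show "(\<lambda>i\<in>I. nat \<lfloor>n - (\<lambda>i\<in>I. n - real (a i)) i\<rfloor>) = a"
  proof
    fix i
    show "(\<lambda>i\<in>I. nat \<lfloor>n - (\<lambda>i\<in>I. n - real (a i)) i\<rfloor>) i = a i"
      using PiE_arb[OF a, of i] by (cases "i \<in> I") auto
  qed
  have "n - real (a i) \<in> steps n" if "i \<in> I" for i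
  proof -
    have "a i \<le> N" using a that by auto
    moreover have "n + (n - real (a i)) = of_int (int N - int (a i))" using assms by simp
    ultimately show ?thesis using assms by (auto simp: steps_def)
  qed
  thus "(\<lambda>i\<in>I. n - real (a i)) \<in> I \<rightarrow>\<^sub>E steps n" by auto
qed

lemma qGamma_ratio_product:
  assumes q: "0 < q" "q < 1" and N: "Suc N = m + r"
  shows "(\<Prod>i=1..r. qGamma q (real N + 1) / qGamma q (real N - real i + 2)) =
    (\<Prod>i=1..r. (1 / (1 - q)) ^ (r - i)) * (qpoch_nat q N ^ r / (\<Prod>k\<in>{m..<m + r}. qpoch_nat q k))"
proof -
  have "(\<Prod>i=1..r. qGamma q (real N + 1) / qGamma q (real N - real i + 2)) =
      (\<Prod>i=1..r. (1 / (1 - q)) ^ (i - 1) * (qpoch_nat q N / qpoch_nat q (N + 1 - i)))"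
  proof (rule prod.cong)
    fix i assume "i \<in> {1..r}"
    hence i: "1 \<le> i" "i \<le> N + 1" using N by auto
    hence "real N - real i + 2 = real (N + 1 - i) + 1" by (simp add: of_nat_diff)
    moreover have "(1 - q) ^ N = (1 - q) ^ (N + 1 - i) * (1 - q) ^ (i - 1)"
      using i by (simp flip: power_add)
    ultimately show "qGamma q (real N + 1) / qGamma q (real N - real i + 2) =
        (1 / (1 - q)) ^ (i - 1) * (qpoch_nat q N / qpoch_nat q (N + 1 - i))"
      using q by (simp only: qGamma_of_nat[OF q]) (simp add: power_divide field_simps)
  qed simp
  also have "\<dots> = (\<Prod>i=1..r. (1 / (1 - q)) ^ (i - 1)) *
      (qpoch_nat q N ^ r / (\<Prod>i=1..r. qpoch_nat q (N + 1 - i)))"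
    by (simp add: prod.distrib prod_dividef)
  also have "(\<Prod>i=1..r. (1 / (1 - q)) ^ (i - 1)) = (\<Prod>i=1..r. (1 / (1 - q)) ^ (r - i))"
    by (rule prod.reindex_bij_witness[of _ "\<lambda>i. r + 1 - i" "\<lambda>i. r + 1 - i"]) auto
  also have "(\<Prod>i=1..r. qpoch_nat q (N + 1 - i)) = (\<Prod>k\<in>{m..<m + r}. qpoch_nat q k)"
    by (rule prod.reindex_bij_witness[of _ "\<lambda>k. N + 1 - k" "\<lambda>i. N + 1 - i"]) (use N in auto)
  finally show ?thesis .
qed

theorem proposition5p1:
  fixes q n :: real and r :: nat
  assumes "0 < q" and "q < 1"
    and "r \<ge> 1"
    and "n \<in> \<int> \<or> n - 1/2 \<in> \<int>"
    and "n \<ge> (real r - 1) / 2"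
  shows "(\<Sum>k \<in> {1..r} \<rightarrow>\<^sub>E steps n.
            (\<Prod>(i, j) \<in> {(i, j). 1 \<le> i \<and> i < j \<and> j \<le> r}. \<bar>qbracket q (k i - k j)\<bar>) *
            (\<Prod>i=1..r. q powr ((k i + n - real r + real i)\<^sup>2 / 2) *
                       qbinom q \<lfloor>2 * n\<rfloor> \<lfloor>n + k i\<rfloor>))
       = fact r / qfact (q powr (1/2)) r *
         (\<Prod>i=1..r. qpoch (- (q powr (1/2))) (q powr (1/2)) (int i) *
                    qpoch (- (q powr (real i / 2 + 1))) q (\<lfloor>2 * n\<rfloor> - int r)) *
         (\<Prod>i=1..r. qGamma q (1 + real i / 2) / qGamma q (3/2) *
                    (qGamma q (2 * n + 1) * qGamma q (2 * n - real i + 5/2) /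
                     (qGamma q (2 * n - real i + 2) * qGamma q (2 * n - real i / 2 + 2))))"
    (is "?lhs = ?rhs")
proof -
  note q = assms(1,2)
  have "2 * n \<in> \<int>"
    using assms(4)
  proof
    assume "n - 1/2 \<in> \<int>"
    then obtain z where "n - 1/2 = of_int z" by (elim Ints_cases)
    hence "2 * n = of_int (2 * z + 1)" by simp
    thus ?thesis by (metis Ints_of_int)
  qed auto
  then obtain z where z: "2 * n = of_int z" by (elim Ints_cases)
  have "n \<ge> 0" using assms(3,5) by (simp add: field_simps)
  hence "z \<ge> 0" using z by (metis of_int_0_le_iff mult_nonneg_nonneg zero_le_numeral)
  hence N: "2 * n = real (nat z)" using z by simp
  define N where "N = nat z"
  note N = N[folded N_def]
  have "real r \<le> real (Suc N)" using assms(5) N by simp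
  then obtain m where m: "Suc N = m + r"
    by (metis le_add_diff_inverse2 of_nat_le_iff)
  have rm: "real N = real m + real r - 1" using arg_cong[OF m, of real] by simp
  have fl: "\<lfloor>2 * n\<rfloor> = int N" using N by simp
  define K where "K = (\<Prod>i=1..r. (1 / (1 - q)) ^ (r - i))"
  define R where "R = qpoch_nat q N ^ r / (\<Prod>k\<in>{m..<m + r}. qpoch_nat q k)"
  define X where "X = box_denom q r m / box_denom q 0 m"
  define s where "s = q powr (1/2)"
  let ?G = "qGamma q"
  have pairs: "{(i, j). 1 \<le> i \<and> i < j \<and> j \<le> r} = pairs {1..r}"
    by (auto simp: pairs_def)
  have "?lhs = (\<Sum>a\<in>{1..r} \<rightarrow>\<^sub>E {..N}.
      (\<Prod>(i, j)\<in>pairs {1..r}. \<bar>qbracket q (real (a j) - real (a i))\<bar>) *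
      (\<Prod>i=1..r. q powr ((real N - real (a i) - real r + real i)\<^sup>2 / 2) *
         qbinom q (int N) (int N - int (a i))))"
    unfolding sum_over_steps[OF N] pairs fl
  proof (rule sum.cong[OF refl], rule arg_cong2[of _ _ _ _ "(*)"])
    fix a :: "nat \<Rightarrow> nat"
    let ?k = "\<lambda>i\<in>{1..r}. n - real (a i)"
    show "(\<Prod>(i, j)\<in>pairs {1..r}. \<bar>qbracket q (?k i - ?k j)\<bar>) =
        (\<Prod>(i, j)\<in>pairs {1..r}. \<bar>qbracket q (real (a j) - real (a i))\<bar>)"
      by (rule prod_pairs_cong) simp
    show "(\<Prod>i=1..r. q powr ((?k i + n - real r + real i)\<^sup>2 / 2) * qbinom q (int N) \<lfloor>n + ?k i\<rfloor>) =
        (\<Prod>i=1..r. q powr ((real N - real (a i) - real r + real i)\<^sup>2 / 2) *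
           qbinom q (int N) (int N - int (a i)))"
    proof (rule prod.cong[OF refl])
      fix i assume i: "i \<in> {1..r}"
      hence "?k i + n = real N - real (a i)" using N by simp
      moreover have "n + ?k i = of_int (int N - int (a i))" using i N by simp
      hence "\<lfloor>n + ?k i\<rfloor> = int N - int (a i)" by (simp only: floor_of_int)
      ultimately show "q powr ((?k i + n - real r + real i)\<^sup>2 / 2) * qbinom q (int N) \<lfloor>n + ?k i\<rfloor> =
          q powr ((real N - real (a i) - real r + real i)\<^sup>2 / 2) * qbinom q (int N) (int N - int (a i))"
        by (simp only:)
    qed
  qed
  also have "\<dots> = K * (fact r * R * X)"
    unfolding K_def R_def X_def vandermonde_binomial_sum[OF q m, symmetric] sum_distrib_left
    by (intro sum.cong refl summand_conversion[OF q m])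
  also have "\<dots> = fact r * X * (\<Prod>i=1..r. ?G (real N + 1) / ?G (real N - real i + 2))"
    unfolding qGamma_ratio_product[OF q m] K_def R_def by (simp only: mult_ac)
  also have "X = (\<Prod>i=1..r. qpoch (- s) s (int i) * qpoch (- (q powr (real i / 2 + 1))) q (int m - 1)) *
      ((\<Prod>i=1..r. ?G (1 + real i / 2) / ?G (3/2)) *
       ((\<Prod>i=1..r. ?G (real m + real i + 1/2)) / (\<Prod>i=1..r. ?G (real m + real r + 1 - real i / 2)))) / qfact s r"
    unfolding X_def gamma_product_eq_box[OF q, symmetric] gamma_product_def s_def[symmetric]
    by (simp only: prod.distrib prod_dividef mult.assoc)
  also have "(\<Prod>i=1..r. ?G (real m + real i + 1/2)) = (\<Prod>i=1..r. ?G (real N - real i + 5/2))"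
    by (rule prod.reindex_bij_witness[of _ "\<lambda>i. r + 1 - i" "\<lambda>i. r + 1 - i"])
       (auto simp: rm of_nat_diff intro!: arg_cong[of _ _ ?G])
  also have "(\<Prod>i=1..r. ?G (real m + real r + 1 - real i / 2)) = (\<Prod>i=1..r. ?G (real N - real i / 2 + 2))"
    by (rule prod.cong) (auto simp: rm intro!: arg_cong[of _ _ ?G])
  also have "fact r * ((\<Prod>i=1..r. qpoch (- s) s (int i) * qpoch (- (q powr (real i / 2 + 1))) q (int m - 1)) *
      ((\<Prod>i=1..r. ?G (1 + real i / 2) / ?G (3/2)) *
       ((\<Prod>i=1..r. ?G (real N - real i + 5/2)) / (\<Prod>i=1..r. ?G (real N - real i / 2 + 2)))) / qfact s r) *
      (\<Prod>i=1..r. ?G (real N + 1) / ?G (real N - real i + 2)) =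
     fact r / qfact s r *
       (\<Prod>i=1..r. qpoch (- s) s (int i) * qpoch (- (q powr (real i / 2 + 1))) q (int m - 1)) *
       (\<Prod>i=1..r. ?G (1 + real i / 2) / ?G (3/2) *
         (?G (real N + 1) * ?G (real N - real i + 5/2) /
           (?G (real N - real i + 2) * ?G (real N - real i / 2 + 2))))"
    by (simp add: prod.distrib prod_dividef mult_ac)
  also have "\<dots> = ?rhs"
  proof -
    have "int m - 1 = int N - int r" using m by simp
    thus ?thesis by (simp only: s_def N floor_of_nat)
  qed
  finally show ?thesis .
qed

end
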